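(* For every positive integer $j$ the polynomial $M_j(x):=(-1)^{j-1}\,x\,Q^*_{j-1}(-x)$ coincides with the Narayana polynomial $N_j(x)$.
   Context: Notation: $C_n^k=\binom nk$ (equal to $0$ if $k<0$ or $k>n$). Narayana polynomials: $N_n(x)=\sum_{k=1}^{n}N_{n,k}x^k$, where $N_{n,k}=\frac1n C_n^{k-1}C_n^k$, $1\le k\le n$. Schur-Szegő composition: for polynomials $P_i=\sum_{k=0}^n p_{i,k}x^k$ ($i=1,\dots,s$), regarded as polynomials of degree $n$ (leading coefficients may vanish), $P_1 *_n\cdots *_n P_s=\sum_{k=0}^n p_{1,k}\cdots p_{s,k}\,x^k/(C_n^k)^{s-1}$. The map $\Phi_n$: for $a\in\mathbb C$ let $K_a=(x+1)^{n-1}(x+a)$. Every monic complex polynomial $P$ of degree $n$ with $P(-1)=0$ can be written as $P=K_{a_1}*_n\cdots *_n K_{a_{n-1}}$, the multiset $\{a_1,\dots,a_{n-1}\}$ being unique. Write $P=(x+1)(x^{n-1}+c_1x^{n-2}+\cdots+c_{n-1})$ and let $\sigma_\nu$ be the $\nu$-th elementary symmetric function of $a_1,\dots,a_{n-1}$. Then $\Phi_n:(c_1,\dots,c_{n-1})\mapsto(\sigma_1,\dots,\sigma_{n-1})$ is an affine (linear inhomogeneous) map. Its eigenvalues and eigenvectors are those of its linear part, a vector $(c_1,\dots,c_{n-1})$ being identified with the polynomial $(x+1)(c_1x^{n-2}+\cdots+c_{n-1})$. The polynomials $Q_{j,n}$ and $Q_j^*$ (known facts from earlier work): $\Phi_n$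 has $n-1$ distinct eigenvalues $\lambda_{1,n}=1$ and $\lambda_{j+2,n}=\frac{n^{j+1}}{(n-1)(n-2)\cdots(n-j-1)}$, $0\le j\le n-3$. The eigenvector for $\lambda_{1,n}$ is $(x+1)^{n-1}$, and for $0\le j\le n-3$ the eigenvector for $\lambda_{j+2,n}$ is $x(x+1)^{n-j-2}Q_{j,n}(x)$, where $Q_{j,n}$ is a uniquely determined monic polynomial of degree $j$ with $Q_{j,n}(-1)\ne0$ (so $Q_{0,n}=1$). Equivalently, if $-a_1,\dots,-a_j$ are the roots of $Q_{j,n}$, then $x(x+1)^{n-j-2}Q_{j,n}(x)=\lambda_{j+2,n}\; K_0 *_n K_{a_1}*_n\cdots *_n K_{a_j}*_n (x+1)^{n-1}$. For fixed $j$, as $n\to\infty$ the polynomials $Q_{j,n}$ converge coefficientwise to a monic polynomial of degree $j$, denoted $Q_j^*(x)$ (so $Q_0^*=1$). *)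

theory Defs
  imports
    Complex_Main
    "HOL-Computational_Algebra.Polynomial"
    "Jordan_Normal_Form.Matrix"
begin

definition narayana :: "nat \<Rightarrow> complex poly" where
  "narayana n = (\<Sum>k=1..n. monom (of_nat (n choose (k - 1)) * of_nat (n choose k) / of_nat n) k)"

text \<open>The Schur-Szego composition of \<open>P 1, \<dots>, P s\<close> (with \<open>s \<ge> 1\<close>), all regarded as
  polynomials of degree \<open>n\<close>.\<close>

definition schur_szego :: "nat \<Rightarrow> nat \<Rightarrow> (nat \<Rightarrow> complex poly) \<Rightarrow> complex poly" where
  "schur_szego n s P =
     (\<Sum>k\<le>n. monom ((\<Prod>i=1..s. coeff (P i) k) / of_nat (n choose k) ^ (s - 1)) k)"

definition K_poly :: "nat \<Rightarrow> complex \<Rightarrow> complex poly" where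
  "K_poly n a = [:1, 1:] ^ (n - 1) * [:a, 1:]"

definition elem_sym :: "nat \<Rightarrow> nat \<Rightarrow> (nat \<Rightarrow> complex) \<Rightarrow> complex" where
  "elem_sym s \<nu> a = (\<Sum>S | S \<subseteq> {1..s} \<and> card S = \<nu>. \<Prod>i\<in>S. a i)"

text \<open>A tuple \<open>(c\<^sub>1, \<dots>, c\<^sub>n\<^sub>-\<^sub>1)\<close> is a vector of dimension \<open>n - 1\<close>; as vectors are indexed
  from \<open>0\<close>, \<open>c\<^sub>\<nu>\<close> is the entry with index \<open>\<nu> - 1\<close>. The following is
  \<open>c\<^sub>1 x\<^sup>n\<^sup>-\<^sup>2 + \<dots> + c\<^sub>n\<^sub>-\<^sub>1\<close>.\<close>

definition vec_poly :: "nat \<Rightarrow> complex vec \<Rightarrow> complex poly" where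
  "vec_poly n c = (\<Sum>\<nu>=1..n-1. monom (c $ (\<nu> - 1)) (n - 1 - \<nu>))"

text \<open>The numbers \<open>a 1, \<dots>, a (n - 1)\<close> below are unique only up to order, but their elementary
  symmetric functions do not depend on the order.\<close>

definition Phi :: "nat \<Rightarrow> complex vec \<Rightarrow> complex vec" where
  "Phi n c = (THE s. \<exists>a.
     [:1, 1:] * (monom 1 (n - 1) + vec_poly n c) = schur_szego n (n - 1) (\<lambda>i. K_poly n (a i)) \<and>
     s = vec (n - 1) (\<lambda>i. elem_sym (n - 1) (i + 1) a))"

text \<open>\<open>Phi n\<close> is affine, so its linear part is obtained by subtracting its value at \<open>0\<close>.\<close>

definition Phi_lin :: "nat \<Rightarrow> complex vec \<Rightarrow> complex vec" where
  "Phi_lin n c = Phi n c - Phi n (0\<^sub>v (n - 1))"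

definition Phi_eigenvector :: "nat \<Rightarrow> complex \<Rightarrow> complex vec \<Rightarrow> bool" where
  "Phi_eigenvector n l c \<longleftrightarrow>
     c \<in> carrier_vec (n - 1) \<and> c \<noteq> 0\<^sub>v (n - 1) \<and> Phi_lin n c = l \<cdot>\<^sub>v c"

text \<open>\<open>eigval j n\<close> is the eigenvalue usually numbered \<open>\<lambda>\<^sub>j\<^sub>+\<^sub>2\<^sub>,\<^sub>n\<close>, for \<open>j + 3 \<le> n\<close>.\<close>

definition eigval :: "nat \<Rightarrow> nat \<Rightarrow> complex" where
  "eigval j n = of_nat n ^ (j + 1) / (\<Prod>i=1..j+1. of_nat n - of_nat i)"

text \<open>Meaningful for \<open>j + 3 \<le> n\<close> only.\<close>

definition Q_poly :: "nat \<Rightarrow> nat \<Rightarrow> complex poly" where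
  "Q_poly j n = (THE q. degree q = j \<and> lead_coeff q = 1 \<and> poly q (-1) \<noteq> 0 \<and>
     (\<exists>c. Phi_eigenvector n (eigval j n) c \<and>
          [:1, 1:] * vec_poly n c = [:0, 1:] * [:1, 1:] ^ (n - j - 2) * q))"

definition Qstar :: "nat \<Rightarrow> complex poly" where
  "Qstar j = (THE q. \<forall>k. (\<lambda>n. coeff (Q_poly j n) k) \<longlonglongrightarrow> coeff q k)"

definition M_poly :: "nat \<Rightarrow> complex poly" where
  "M_poly j = Polynomial.smult ((-1) ^ (j - 1)) ([:0, 1:] * pcompose (Qstar (j - 1)) [:0, -1:])"

end

theory Submission
  imports Defs
    "HOL-Combinatorics.Stirling"
    "HOL-Computational_Algebra.Fundamental_Theorem_Algebra"
begin

text \<open>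
  The coefficient of \<open>x^k\<close> in \<open>K_a\<close> is \<open>(n choose k) * (k + a * (n - k)) / n\<close>.
  Hence the composition of \<open>K_a\<close> over \<open>a = a_1, \<dots>, a_{n-1}\<close> has the coefficients
  \<open>(n choose k) * G(k, n - k) / n^(n-1)\<close>, where \<open>G\<close> is the homogenization of
  \<open>g = (x + a_1) \<dots> (x + a_{n-1})\<close>. The polynomial \<open>g\<close> carries the numbers \<open>\<sigma>_\<nu>\<close> as coefficients and
  depends linearly on the composed polynomial \<open>P\<close>; below it is called the symbol of \<open>P\<close>. So
  \<open>\<Phi>_n\<close> sends the cofactor of \<open>x + 1\<close> in \<open>P\<close> to the symbol of \<open>P\<close>, and \<open>V\<close> (of degree at most
  \<open>n - 2\<close>) represents an eigenvector for \<open>\<lambda>\<close> iff \<open>\<lambda> * V\<close> is the symbol of \<open>(x + 1) * V\<close>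
  (\<open>Phi_eigenvector_iff\<close>).

  For \<open>V = x * (x + 1)^(n-j-3) * q\<close> and \<open>q = b_0 + b_1 * (x + 1) + \<dots> + b_j * (x + 1)^j\<close> this condition
  is explicit: \<open>u + v = n\<close> at \<open>(u, v) = (k, n - k)\<close>, so that the homogenization of \<open>V\<close> becomes
  \<open>k * (n - k) * n^(n-j-3)\<close> times a polynomial in \<open>n - k\<close>. A polynomial in \<open>n - k\<close> multiplied by binomial
  coefficients is again a combination of powers of \<open>x + 1\<close>, with Stirling numbers as coefficients.
  Comparing the powers of \<open>x + 1\<close> gives a triangular linear system for the \<open>b_r\<close>
  (\<open>symbol_eigenpoly_iff\<close>), which determines \<open>b_1, \<dots>, b_j\<close> from \<open>b_0\<close> (\<open>eigen_equations_iff\<close>).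

  As \<open>n\<close> grows, only the two leading Stirling numbers of each row survive, and the system tends to the
  two-term recursion \<open>b_{r+1} = - b_r * (j - r) * (j + 1 - r) / ((r + 1) * (2 * j + 2 - r))\<close>. Its solution is
  proportional to \<open>(-1)^r * ((j+1) choose r) * ((2*j+2-r) choose (j+2))\<close> (\<open>tendsto_Q_coeff\<close>). Up to
  signs and a common factor, these are the Taylor coefficients at \<open>1\<close> of \<open>N_{j+1}(x) / x\<close>, by Vandermonde's identity
  (\<open>narayana_expansion_at_1\<close>).
\<close>

section \<open>Homogenization of polynomials\<close>

text \<open>
  The degree \<open>d\<close> of homogenization is a parameter, not the degree of the polynomial. This makes
  homogenization linear, and multiplication by a constant \<open>[:\<beta>, 0:]\<close> can raise \<open>d\<close>, which brings
  in a power of \<open>v\<close>.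
\<close>

definition homog :: "nat \<Rightarrow> complex poly \<Rightarrow> complex \<Rightarrow> complex \<Rightarrow> complex" where
  "homog d g u v = (\<Sum>i\<le>d. coeff g i * u ^ i * v ^ (d - i))"

lemma homog_add: "homog d (g + h) u v = homog d g u v + homog d h u v"
  by (simp add: homog_def sum.distrib algebra_simps)

lemma homog_diff: "homog d (g - h) u v = homog d g u v - homog d h u v"
  by (simp add: homog_def sum_subtractf algebra_simps)

lemma homog_smult: "homog d (Polynomial.smult c g) u v = c * homog d g u v"
  by (simp add: homog_def sum_distrib_left mult_ac)

lemma homog_mult_linear:
  assumes "degree g \<le> d"
  shows "homog (Suc d) (g * [:\<beta>, \<alpha>:]) u v = (\<alpha> * u + \<beta> * v) * homog d g u v"
proof -
  have top: "coeff g (Suc d) = 0"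
    using assms by (simp add: coeff_eq_0)
  have "homog (Suc d) (Polynomial.smult \<beta> g) u v = \<beta> * v * homog d g u v"
    by (simp add: homog_def sum_distrib_left top)
      (auto intro!: sum.cong simp: Suc_diff_le)
  moreover have "homog (Suc d) (pCons 0 (Polynomial.smult \<alpha> g)) u v = \<alpha> * u * homog d g u v"
    unfolding homog_def
    by (subst sum.atMost_Suc_shift) (simp add: sum_distrib_left mult_ac)
  ultimately show ?thesis
    by (simp add: homog_add algebra_simps)
qed

lemma degree_prod_linear_le:
  assumes "finite I"
  shows "degree (\<Prod>i\<in>I. [:b i, a i:] :: complex poly) \<le> card I"
proof -
  have "degree (\<Prod>i\<in>I. [:b i, a i:]) \<le> (\<Sum>i\<in>I. degree [:b i, a i:])"
    using degree_prod_sum_le[OF assms, of "\<lambda>i. [:b i, a i:]"] unfolding o_def .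
  also have "\<dots> \<le> (\<Sum>i\<in>I. 1)"
    by (rule sum_mono) (simp add: order.trans[OF degree_pCons_le])
  finally show ?thesis by simp
qed

lemma homog_prod_linear:
  assumes "finite I"
  shows "homog (card I) (\<Prod>i\<in>I. [:b i, a i:]) u v = (\<Prod>i\<in>I. a i * u + b i * v)"
  using assms
proof (induction I rule: finite_induct)
  case empty
  show ?case by (simp add: homog_def)
next
  case (insert i I)
  have "degree (\<Prod>i\<in>I. [:b i, a i:]) \<le> card I"
    using insert.hyps(1) by (rule degree_prod_linear_le)
  then show ?case
    using insert homog_mult_linear[of "\<Prod>i\<in>I. [:b i, a i:]" "card I" "b i" "a i" u v]
    by (simp add: mult.commute del: mult_pCons_left mult_pCons_right)
qed

lemma homog_mult_binomial_power:
  assumes "degree g \<le> d"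
  shows "homog (d + k) (g * [:1, 1:] ^ k) u v = (u + v) ^ k * homog d g u v"
proof (induction k)
  case (Suc k)
  have "degree (g * [:1, 1:] ^ k) \<le> d + k"
    using assms by (intro order.trans[OF degree_mult_le] add_mono) (simp_all add: degree_linear_power)
  from homog_mult_linear[OF this, of 1 1 u v] Suc show ?case
    by (simp add: mult_ac del: mult_pCons_left mult_pCons_right)
qed simp

text \<open>
  Dehomogenization: for \<open>v \<noteq> 0\<close> the values of the form are values of the polynomial, so a form that
  vanishes at sufficiently many different ratios \<open>u / v\<close> is zero.
\<close>
lemma homog_eq_poly:
  assumes "degree g \<le> d" "v \<noteq> 0"
  shows "homog d g u v = v ^ d * poly g (u / v)"
proof -
  have "poly g (u / v) = (\<Sum>i\<le>d. coeff g i * (u / v) ^ i)"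
    unfolding poly_altdef
    by (rule sum.mono_neutral_left) (use assms in \<open>auto simp: coeff_eq_0\<close>)
  moreover have "coeff g i * u ^ i * v ^ (d - i) = v ^ d * (coeff g i * (u / v) ^ i)"
    if "i \<le> d" for i
    using assms that by (simp add: power_divide power_diff)
  then have "homog d g u v = v ^ d * (\<Sum>i\<le>d. coeff g i * (u / v) ^ i)"
    unfolding homog_def sum_distrib_left by (intro sum.cong) auto
  ultimately show ?thesis by simp
qed

section \<open>The symbol of a polynomial with the root -1\<close>

text \<open>
  The symbol of a composition of \<open>K_poly n (a i)\<close>, \<open>1 \<le> i \<le> n - 1\<close>, is the product of the
  \<open>x + a i\<close>; see \<open>symbol_schur_szego_K\<close>. The bounds on the degrees are part of the relation
  so that the two polynomials determine each other.
\<close>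

definition symbol :: "nat \<Rightarrow> complex poly \<Rightarrow> complex poly \<Rightarrow> bool" where
  "symbol n P g \<longleftrightarrow> degree P \<le> n \<and> degree g \<le> n - 1 \<and>
     (\<forall>k\<le>n. of_nat n ^ (n - 1) * coeff P k =
        of_nat (n choose k) * homog (n - 1) g (of_nat k) (of_nat (n - k)))"

lemma symbol_add:
  assumes "symbol n P g" "symbol n R h"
  shows "symbol n (P + R) (g + h)"
  using assms by (auto simp: symbol_def homog_add algebra_simps intro: degree_add_le)

lemma symbol_diff:
  assumes "symbol n P g" "symbol n R h"
  shows "symbol n (P - R) (g - h)"
  using assms by (auto simp: symbol_def homog_diff algebra_simps intro: degree_diff_le)

lemma symbol_smult:
  assumes "symbol n P g"
  shows "symbol n (Polynomial.smult c P) (Polynomial.smult c g)"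
  using assms unfolding symbol_def
  by (auto simp: homog_smult mult_ac intro: order.trans[OF degree_smult_le])

lemma symbol_0: "symbol n 0 0"
  by (simp add: symbol_def homog_def)

lemma symbol_sum:
  assumes "finite I" "\<And>i. i \<in> I \<Longrightarrow> symbol n (P i) (g i)"
  shows "symbol n (sum P I) (sum g I)"
  using assms by (induction I rule: finite_induct) (auto simp: symbol_0 symbol_add)

text \<open>
  The values of the homogenized symbol are prescribed at the \<open>n\<close> different ratios \<open>k / (n - k)\<close>,
  \<open>k < n\<close>, and a polynomial of degree at most \<open>n - 1\<close> is determined by \<open>n\<close> values. This is why the
  numbers \<open>a i\<close> in a composition are unique up to order.
\<close>
lemma symbol_unique:
  assumes "symbol n P g" "symbol n P h" "n \<ge> 1"
  shows "g = h"
proof (rule poly_eqI_degree)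
  let ?t = "\<lambda>k. of_nat k / of_nat (n - k) :: complex"
  \<comment> \<open>The index \<open>k = n\<close> is left out: its ratio is infinite.\<close>
  have inj: "inj_on ?t {..<n}"
  proof (rule inj_onI)
    fix k l assume kl: "k \<in> {..<n}" "l \<in> {..<n}" and "?t k = ?t l"
    then have "(of_nat (k * (n - l)) :: complex) = of_nat (l * (n - k))"
      by (simp add: field_simps)
    then have "k * (n - l) = l * (n - k)"
      using of_nat_eq_iff by blast
    moreover have "k * (n - l) + k * l = k * n" "l * (n - k) + l * k = l * n"
      using kl by (simp_all flip: add_mult_distrib2)
    ultimately have "k * n = l * n" by (simp add: mult.commute)
    then show "k = l" using kl by auto
  qed
  show "poly g x = poly h x" if "x \<in> ?t ` {..<n}" for x
  proof -
    from that obtain k where k: "k < n" "x = ?t k" by (meson imageE lessThan_iff)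
    then have "homog (n - 1) g (of_nat k) (of_nat (n - k))
        = homog (n - 1) h (of_nat k) (of_nat (n - k))"
      using assms(1,2) unfolding symbol_def
      by (metis (no_types, lifting) binomial_eq_0_iff less_imp_le mult_left_cancel not_less of_nat_eq_0_iff)
    then show ?thesis
      using k assms(1,2) unfolding symbol_def by (simp add: homog_eq_poly)
  qed
  show "card (?t ` {..<n}) > degree g" "card (?t ` {..<n}) > degree h"
    unfolding card_image[OF inj] using assms by (auto simp: symbol_def)
qed

lemma symbol_inj:
  assumes "symbol n P g" "symbol n R g"
  shows "P = R"
proof (rule poly_eqI)
  fix k
  show "coeff P k = coeff R k"
  proof (cases "k \<le> n")
    case True
    then have "of_nat n ^ (n - 1) * coeff P k = of_nat n ^ (n - 1) * coeff R k"
      using assms by (simp add: symbol_def)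
    then show ?thesis by (cases "n = 0") auto
  next
    case False
    then show ?thesis using assms by (simp add: symbol_def coeff_eq_0)
  qed
qed

lemma coeff_binomial_power: "coeff ([:1, 1:] ^ d) k = (of_nat (d choose k) :: complex)"
  by (cases "k \<le> d") (simp_all add: coeff_linear_poly_power coeff_eq_0 degree_linear_power)

lemma coeff_K_poly:
  assumes "n \<ge> 1" "k \<le> n"
  shows "of_nat n * coeff (K_poly n a) k = of_nat (n choose k) * (of_nat k + a * of_nat (n - k))"
proof -
  note pow = coeff_binomial_power[of "n - 1"]
  have 1: "of_nat n * (of_nat ((n - 1) choose k) :: complex) = of_nat (n - k) * of_nat (n choose k)"
    by (metis binomial_absorb_comp of_nat_mult)
  have 2: "of_nat n * (of_nat ((n - 1) choose (k - 1)) :: complex) = of_nat k * of_nat (n choose k)"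
    if "k > 0" using that by (metis times_binomial_minus1_eq of_nat_mult)
  show ?thesis
  proof (cases "k = 0")
    case True
    then show ?thesis
      using pow[of 0] by (simp add: K_poly_def coeff_mult del: mult_pCons_right)
  next
    case False
    then obtain i where k: "k = Suc i" using not0_implies_Suc by blast
    have "of_nat n * coeff (K_poly n a) k
        = a * (of_nat n * of_nat ((n - 1) choose k)) + of_nat n * of_nat ((n - 1) choose (k - 1))"
      by (simp add: K_poly_def pow[simplified] k algebra_simps)
    then show ?thesis
      using 1 2 False by (simp add: algebra_simps)
  qed
qed

lemma coeff_schur_szego:
  "coeff (schur_szego n s P) k =
     (if k \<le> n then (\<Prod>i=1..s. coeff (P i) k) / of_nat (n choose k) ^ (s - 1) else 0)"
  by (auto simp: schur_szego_def coeff_sum)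

text \<open>
  The composition multiplies the factors \<open>k + a i * (n - k)\<close> of the coefficients, and these are the
  homogenized linear factors \<open>x + a i\<close>.
\<close>
lemma symbol_schur_szego_K:
  assumes "n \<ge> 2"
  shows "symbol n (schur_szego n (n - 1) (\<lambda>i. K_poly n (a i))) (\<Prod>i=1..n-1. [:a i, 1:])"
proof -
  let ?S = "schur_szego n (n - 1) (\<lambda>i. K_poly n (a i))"
  have "degree ?S \<le> n"
    by (rule degree_le) (simp add: coeff_schur_szego)
  moreover have "degree (\<Prod>i=1..n-1. [:a i, 1:]) \<le> n - 1"
    using degree_prod_linear_le[of "{1..n-1}"] by simp
  moreover have "of_nat n ^ (n - 1) * coeff ?S k = of_nat (n choose k) *
      homog (n - 1) (\<Prod>i=1..n-1. [:a i, 1:]) (of_nat k) (of_nat (n - k))" if k: "k \<le> n" for k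
  proof -
    have "of_nat n ^ (n - 1) * (\<Prod>i=1..n-1. coeff (K_poly n (a i)) k)
        = (\<Prod>i=1..n-1. of_nat n * coeff (K_poly n (a i)) k)"
      by (simp add: prod.distrib)
    also have "\<dots> = (\<Prod>i=1..n-1. of_nat (n choose k) * (of_nat k + a i * of_nat (n - k)))"
      using assms k by (intro prod.cong) (simp_all add: coeff_K_poly)
    also have "\<dots> = of_nat (n choose k) ^ (n - 1) * (\<Prod>i=1..n-1. 1 * of_nat k + a i * of_nat (n - k))"
      by (simp add: prod.distrib)
    also have "(\<Prod>i=1..n-1. 1 * of_nat k + a i * of_nat (n - k)) =
        homog (n - 1) (\<Prod>i=1..n-1. [:a i, 1:]) (of_nat k) (of_nat (n - k))"
      using homog_prod_linear[of "{1..n-1}" a "\<lambda>_. 1"] by simp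
    also have "of_nat (n choose k) ^ (n - 1) =
        (of_nat (n choose k) * of_nat (n choose k) ^ (n - 1 - 1) :: complex)"
      using assms by (simp flip: power_Suc add: Suc_diff_Suc numeral_2_eq_2)
    finally show ?thesis
      using k by (simp add: coeff_schur_szego field_simps)
  qed
  ultimately show ?thesis by (simp add: symbol_def)
qed

lemma coeff_prod_linear_elem_sym:
  assumes "\<nu> \<le> m"
  shows "coeff (\<Prod>i=1..m. [:a i, 1:]) (m - \<nu>) = elem_sym m \<nu> a"
proof -
  have const: "(\<Prod>i\<in>X. [:a i:]) = [:\<Prod>i\<in>X. a i:]" for X
    by (induction X rule: infinite_finite_induct) (auto simp: one_pCons)
  have "(\<Prod>i=1..m. [:a i, 1:]) = (\<Prod>i=1..m. [:a i:] + monom 1 1)"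
    by (simp add: monom_altdef)
  also have "\<dots> = (\<Sum>X\<in>Pow {1..m}. (\<Prod>i\<in>X. [:a i:]) * (\<Prod>i\<in>{1..m}-X. monom 1 1))"
    by (rule prod_add) simp
  also have "\<dots> = (\<Sum>X\<in>Pow {1..m}. monom (\<Prod>i\<in>X. a i) (m - card X))"
    by (intro sum.cong) (auto simp: const monom_power smult_monom card_Diff_subset finite_subset)
  finally have "coeff (\<Prod>i=1..m. [:a i, 1:]) (m - \<nu>)
      = (\<Sum>X\<in>Pow {1..m}. if m - card X = m - \<nu> then (\<Prod>i\<in>X. a i) else 0)"
    by (simp add: coeff_sum)
  also have "\<dots> = (\<Sum>X\<in>{X \<in> Pow {1..m}. m - card X = m - \<nu>}. \<Prod>i\<in>X. a i)"
    by (rule sum.inter_filter[symmetric]) simp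
  also have "{X \<in> Pow {1..m}. m - card X = m - \<nu>} = {S. S \<subseteq> {1..m} \<and> card S = \<nu>}"
  proof -
    have "m - card X = m - \<nu> \<longleftrightarrow> card X = \<nu>" if "X \<subseteq> {1..m}" for X
      using card_mono[OF _ that] assms by auto
    then show ?thesis by auto
  qed
  finally show ?thesis by (simp add: elem_sym_def)
qed

lemma monic_splits:
  fixes g :: "complex poly"
  assumes "lead_coeff g = 1"
  shows "\<exists>a. g = (\<Prod>i=1..degree g. [:a i, 1:])"
proof -
  have "g \<noteq> 0" using assms by auto
  then obtain A where A: "size A = degree g" "g = (\<Prod>x\<in>#A. [:-x, 1:])"
    using alg_closed_imp_factorization[of g] assms by auto
  obtain xs where xs: "mset xs = A" using ex_mset by blast
  have "g = prod_list (map (\<lambda>x. [:-x, 1:]) xs)"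
    using A(2) xs prod_mset_prod_list[of "map (\<lambda>x. [:-x, 1:]) xs"] by simp
  also have "\<dots> = (\<Prod>i=0..<length xs. [:-(xs ! i), 1:])"
    by (subst prod.list_conv_set_nth) (auto intro!: prod.cong)
  also have "\<dots> = (\<Prod>i=1..length xs. [:-(xs ! (i - 1)), 1:])"
    by (rule prod.reindex_bij_witness[of _ "\<lambda>i. i - 1" Suc]) auto
  also have "length xs = degree g" using A(1) xs by auto
  finally show ?thesis by (rule exI[of _ "\<lambda>i. - (xs ! (i - 1))"])
qed

text \<open>The Taylor expansion at \<open>-1\<close>.\<close>
lemma poly_eq_sum_shift:
  fixes p :: "complex poly"
  assumes "degree p \<le> d"
  shows "p = (\<Sum>r\<le>d. Polynomial.smult (coeff (pcompose p [:-1, 1:]) r) ([:1, 1:] ^ r))"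
proof -
  let ?B = "pcompose p [:-1, 1:]"
  have "degree ?B \<le> d"
    using assms by (simp add: degree_pcompose)
  then have "poly ?B y = (\<Sum>r\<le>d. coeff ?B r * y ^ r)" for y
    unfolding poly_altdef by (intro sum.mono_neutral_left) (auto simp: coeff_eq_0)
  from this[of "1 + x" for x]
  have "poly p x = poly (\<Sum>r\<le>d. Polynomial.smult (coeff ?B r) ([:1, 1:] ^ r)) x" for x
    by (simp add: poly_pcompose poly_sum)
  then show ?thesis
    by (simp add: poly_eq_poly_eq_iff[symmetric] fun_eq_iff)
qed

lemma choose_mult_diff:
  "(n choose k) * ((n - k) choose s) = (n choose s) * ((n - s) choose k)"
proof (cases "k + s \<le> n")
  case True
  have "(n choose (n - s)) * ((n - s) choose k) = (n choose k) * ((n - k) choose (n - s - k))"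
    using True by (intro choose_mult) auto
  moreover have "n choose (n - s) = n choose s"
    using True by (intro binomial_symmetric[symmetric]) auto
  moreover have "(n - k) choose (n - s - k) = (n - k) choose s"
  proof -
    have "n - s - k = n - k - s" by simp
    then show ?thesis using True by (simp only: binomial_symmetric[of s "n - k"])
  qed
  ultimately show ?thesis by simp
next
  case False
  have "(n choose k) * ((n - k) choose s) = 0" if "n < k + s" for k s
    using that by (cases "k \<le> n") (auto simp: binomial_eq_0)
  from this[of k s] this[of s k] False show ?thesis
    by (simp only: not_le add.commute)
qed

text \<open>
  For \<open>r = n - s\<close> the coefficient of \<open>x^k\<close> in \<open>(x + 1)^r\<close> is
  \<open>(n choose k) * ((n - k) choose s) / (n choose s)\<close>. Here \<open>(n - k) choose s\<close> is a product of linear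
  factors \<open>n - k - i\<close>, and on the line \<open>u + v = n\<close> both \<open>n * (v - i) = (n - i) * v - i * u\<close> and \<open>n = u + v\<close>
  are linear forms, which gives a form of degree \<open>n - 1\<close>.
\<close>
lemma ex_symbol_binomial_power:
  assumes "1 \<le> r" "r \<le> n"
  shows "\<exists>g. symbol n ([:1, 1:] ^ r) g"
proof -
  define s where "s = n - r"
  have s: "s \<le> n - 1" "r = n - s" using assms by (auto simp: s_def)
  \<comment> \<open>The powers of \<open>x + 1\<close> only fill up the degree to \<open>n - 1\<close>.\<close>
  define g :: "complex poly" where
    "g = (\<Prod>i<s. [:of_nat (n - i), - of_nat i:]) * [:1, 1:] ^ (n - 1 - s)"
  define C where "C = (fact s * of_nat (n choose s) :: complex)"
  have C: "C \<noteq> 0" using s assms by (auto simp: C_def)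
  have deg: "degree (\<Prod>i<s. [:of_nat (n - i), - of_nat i:] :: complex poly) \<le> s"
    using degree_prod_linear_le[of "{..<s}"] by simp
  have dg: "degree g \<le> n - 1"
    unfolding g_def using deg s(1)
    by (intro order.trans[OF degree_mult_le]) (simp add: degree_linear_power)
  have hg: "homog (n - 1) g (of_nat k) (of_nat (n - k)) = of_nat n ^ (n - 1) * (fact s * of_nat ((n - k) choose s))"
    if k: "k \<le> n" for k
  proof -
    have "homog (s + (n - 1 - s)) g (of_nat k) (of_nat (n - k)) =
        (of_nat k + of_nat (n - k)) ^ (n - 1 - s) *
        homog s (\<Prod>i<s. [:of_nat (n - i), - of_nat i:]) (of_nat k) (of_nat (n - k))"
      unfolding g_def by (rule homog_mult_binomial_power[OF deg])
    also have "homog s (\<Prod>i<s. [:of_nat (n - i), - of_nat i:]) (of_nat k) (of_nat (n - k))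
        = (\<Prod>i<s. - of_nat i * of_nat k + of_nat (n - i) * of_nat (n - k) :: complex)"
      using homog_prod_linear[of "{..<s}"] by simp
    also have "\<dots> = (\<Prod>i<s. of_nat n * (of_nat (n - k) - of_nat i))"
      using s k assms by (intro prod.cong) (auto simp: of_nat_diff algebra_simps)
    also have "\<dots> = of_nat n ^ s * (\<Prod>i<s. of_nat (n - k) - of_nat i)"
      by (simp add: prod.distrib)
    also have "(\<Prod>i<s. of_nat (n - k) - of_nat i) = (fact s * of_nat ((n - k) choose s) :: complex)"
      by (simp add: binomial_gbinomial gbinomial_prod_rev atLeast0LessThan)
    also have "(of_nat k + of_nat (n - k) :: complex) = of_nat n"
      using k by (simp add: of_nat_diff)
    finally show ?thesis
      using s(1) by (simp add: power_add[symmetric] mult.assoc[symmetric] del: One_nat_def diff_diff_left)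
  qed
  have "symbol n ([:1, 1:] ^ r) (Polynomial.smult (1 / C) g)"
    unfolding symbol_def
  proof (intro conjI allI impI)
    show "degree ([:1, 1:] ^ r :: complex poly) \<le> n"
      using assms by (simp add: degree_linear_power)
    show "degree (Polynomial.smult (1 / C) g) \<le> n - 1"
      using dg by (meson degree_smult_le order.trans)
    fix k assume k: "k \<le> n"
    have "(n choose k) * ((n - k) choose s) = (n choose s) * (r choose k)"
      unfolding s(2) by (rule choose_mult_diff)
    then have eq: "(of_nat (n choose k) * of_nat ((n - k) choose s) :: complex)
        = of_nat (n choose s) * of_nat (r choose k)"
      by (metis of_nat_mult)
    have "coeff ([:1, 1:] ^ r) k = (of_nat (r choose k) :: complex)"
      by (rule coeff_binomial_power)
    moreover have "of_nat (n choose k) * homog (n - 1) (Polynomial.smult (1 / C) g) (of_nat k) (of_nat (n - k))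
        = of_nat n ^ (n - 1) * fact s * (of_nat (n choose k) * of_nat ((n - k) choose s)) / C"
      using hg[OF k] by (simp add: homog_smult mult_ac)
    ultimately show "of_nat n ^ (n - 1) * coeff ([:1, 1:] ^ r) k =
        of_nat (n choose k) * homog (n - 1) (Polynomial.smult (1 / C) g) (of_nat k) (of_nat (n - k))"
      unfolding eq using C by (simp add: C_def field_simps)
  qed
  then show ?thesis ..
qed

text \<open>
  The condition \<open>poly P (-1) = 0\<close> removes the constant term of the expansion of \<open>P\<close> in powers of
  \<open>x + 1\<close>; the power with exponent \<open>0\<close> would lead to a form of degree \<open>n\<close>.
\<close>
lemma ex_symbol:
  assumes "degree P \<le> n" "poly P (-1) = 0" "n \<ge> 1"
  shows "\<exists>g. symbol n P g"
proof -
  let ?B = "pcompose P [:-1, 1:]"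
  obtain g where g: "\<And>r. r \<in> {1..n} \<Longrightarrow> symbol n ([:1, 1:] ^ r) (g r)"
    using ex_symbol_binomial_power[of _ n] by (simp del: One_nat_def) metis
  have "coeff ?B 0 = 0"
    using assms(2) by (simp add: poly_0_coeff_0[symmetric] poly_pcompose)
  then have "(\<Sum>r\<le>n. Polynomial.smult (coeff ?B r) ([:1, 1:] ^ r)) = (\<Sum>r=1..n. Polynomial.smult (coeff ?B r) ([:1, 1:] ^ r))"
    by (intro sum.mono_neutral_right) (auto simp: not_le)
  then have P: "P = (\<Sum>r=1..n. Polynomial.smult (coeff ?B r) ([:1, 1:] ^ r))"
    using poly_eq_sum_shift[OF assms(1)] by simp
  have "symbol n (\<Sum>r=1..n. Polynomial.smult (coeff ?B r) ([:1, 1:] ^ r)) (\<Sum>r=1..n. Polynomial.smult (coeff ?B r) (g r))"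
    using g by (intro symbol_sum symbol_smult) auto
  then show ?thesis using P by auto
qed

lemma symbol_top_coeff:
  assumes "symbol n P g" "n \<ge> 1"
  shows "coeff g (n - 1) = coeff P n"
proof -
  have "homog (n - 1) g (of_nat n) 0 = (\<Sum>i\<in>{n - 1}. coeff g i * of_nat n ^ i * 0 ^ (n - 1 - i))"
    unfolding homog_def by (rule sum.mono_neutral_right) auto
  then show ?thesis
    using assms by (auto simp: symbol_def)
qed

section \<open>Eigenvectors in terms of symbols\<close>

lemma coeff_vec_poly:
  assumes "n \<ge> 2"
  shows "coeff (vec_poly n c) i = (if i < n - 1 then c $ (n - 2 - i) else 0)"
proof -
  have "coeff (vec_poly n c) i = (\<Sum>\<nu>=1..n-1. if n - 1 - \<nu> = i then c $ (\<nu> - 1) else 0)"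
    by (simp only: vec_poly_def coeff_sum coeff_monom)
  also have "\<dots> = (\<Sum>\<nu>=1..n-1. if n - 1 - i = \<nu> then (if i < n - 1 then c $ (n - 2 - i) else 0) else 0)"
  proof (rule sum.cong[OF refl])
    fix \<nu> assume "\<nu> \<in> {1..n-1}"
    then have "n - 1 - \<nu> = i \<longleftrightarrow> n - 1 - i = \<nu> \<and> i < n - 1"
      and "n - 1 - i = \<nu> \<Longrightarrow> \<nu> - 1 = n - 2 - i" by auto
    then show "(if n - 1 - \<nu> = i then c $ (\<nu> - 1) else 0) =
        (if n - 1 - i = \<nu> then (if i < n - 1 then c $ (n - 2 - i) else 0) else 0)"
      by (simp del: One_nat_def diff_diff_left)
  qed
  also have "\<dots> = (if i < n - 1 then c $ (n - 2 - i) else 0)"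
    by (subst sum.delta') auto
  finally show ?thesis .
qed

lemma degree_vec_poly:
  assumes "n \<ge> 2"
  shows "degree (vec_poly n c) \<le> n - 2"
  using assms by (intro degree_le) (auto simp: coeff_vec_poly)

lemma vec_poly_vec:
  assumes "n \<ge> 2" "degree V \<le> n - 2"
  shows "vec_poly n (vec (n - 1) (\<lambda>i. coeff V (n - 2 - i))) = V"
proof (rule poly_eqI)
  fix i
  have "n - 2 - (n - 2 - i) = i" if "i < n - 1" using that by simp
  then show "coeff (vec_poly n (vec (n - 1) (\<lambda>i. coeff V (n - 2 - i)))) i = coeff V i"
    using assms by (auto simp: coeff_vec_poly coeff_eq_0 simp del: diff_diff_left)
qed

text \<open>
  The symbol of a monic \<open>P\<close> splits into linear factors \<open>x + a i\<close>. These give the required composition,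
  and by uniqueness of the symbol any other composition has the same elementary symmetric functions.
  Thus the definite description defining \<open>Phi\<close> denotes the coefficient vector of the symbol.
\<close>
lemma Phi_eqI:
  assumes "n \<ge> 2" "lead_coeff g = 1" "degree g = n - 1"
    and "symbol n ([:1, 1:] * (monom 1 (n - 1) + vec_poly n c)) g"
  shows "Phi n c = vec (n - 1) (\<lambda>i. coeff g (n - 2 - i))"
  unfolding Phi_def
proof (rule the_equality)
  have vec: "vec (n - 1) (\<lambda>i. elem_sym (n - 1) (i + 1) a) = vec (n - 1) (\<lambda>i. coeff g (n - 2 - i))"
    if "g = (\<Prod>i=1..n-1. [:a i, 1:])" for a
  proof (rule eq_vecI)
    fix i assume "i < dim_vec (vec (n - 1) (\<lambda>i. coeff g (n - 2 - i)))"
    then have "i < n - 1" by simp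
    then have "coeff g (n - 1 - (i + 1)) = elem_sym (n - 1) (i + 1) a"
      unfolding that by (intro coeff_prod_linear_elem_sym) simp
    then show "vec (n - 1) (\<lambda>i. elem_sym (n - 1) (i + 1) a) $ i
        = vec (n - 1) (\<lambda>i. coeff g (n - 2 - i)) $ i"
      using \<open>i < n - 1\<close> by (simp add: numeral_2_eq_2)
  qed simp
  obtain a where a: "g = (\<Prod>i=1..n-1. [:a i, 1:])"
    using monic_splits[OF assms(2)] assms(3) by metis
  have "[:1, 1:] * (monom 1 (n - 1) + vec_poly n c) = schur_szego n (n - 1) (\<lambda>i. K_poly n (a i))"
    using assms(4) symbol_schur_szego_K[OF assms(1), of a] unfolding a[symmetric]
    by (rule symbol_inj)
  then show "\<exists>a. [:1, 1:] * (monom 1 (n - 1) + vec_poly n c) = schur_szego n (n - 1) (\<lambda>i. K_poly n (a i)) \<and>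
      vec (n - 1) (\<lambda>i. coeff g (n - 2 - i)) = vec (n - 1) (\<lambda>i. elem_sym (n - 1) (i + 1) a)"
    using vec[OF a] by metis
  fix s
  assume "\<exists>a. [:1, 1:] * (monom 1 (n - 1) + vec_poly n c) = schur_szego n (n - 1) (\<lambda>i. K_poly n (a i)) \<and>
      s = vec (n - 1) (\<lambda>i. elem_sym (n - 1) (i + 1) a)"
  then obtain b where b: "[:1, 1:] * (monom 1 (n - 1) + vec_poly n c)
        = schur_szego n (n - 1) (\<lambda>i. K_poly n (b i))"
      "s = vec (n - 1) (\<lambda>i. elem_sym (n - 1) (i + 1) b)" by blast
  have "g = (\<Prod>i=1..n-1. [:b i, 1:])"
    using assms(1,4) symbol_schur_szego_K[OF assms(1), of b] unfolding b(1)
    by (intro symbol_unique[of n]) auto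
  then show "s = vec (n - 1) (\<lambda>i. coeff g (n - 2 - i))"
    using b(2) vec by simp
qed

lemma ex_monic_symbol:
  assumes "n \<ge> 2"
  shows "\<exists>g. symbol n ([:1, 1:] * (monom 1 (n - 1) + vec_poly n c)) g \<and>
    lead_coeff g = 1 \<and> degree g = n - 1"
proof -
  let ?W = "monom 1 (n - 1) + vec_poly n c"
  have "degree ?W \<le> n - 1"
    using degree_vec_poly[OF assms, of c]
    by (intro degree_add_le) (auto simp: degree_monom_eq)
  then have deg: "degree ([:1, 1:] * ?W) \<le> n"
    using assms by (intro order.trans[OF degree_mult_le]) simp
  then obtain g where g: "symbol n ([:1, 1:] * ?W) g"
    using ex_symbol[OF deg] assms by auto
  have "coeff g (n - 1) = coeff ([:1, 1:] * ?W) n"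
    using g assms by (intro symbol_top_coeff) auto
  also have "\<dots> = coeff ?W n + coeff ?W (n - 1)"
    using assms by (cases n) auto
  also have "\<dots> = 1"
    using assms by (auto simp: coeff_vec_poly)
  finally have top: "coeff g (n - 1) = 1" .
  moreover have "degree g = n - 1"
    using g top by (intro antisym le_degree) (auto simp: symbol_def)
  ultimately show ?thesis using g by auto
qed

text \<open>
  Passing to the linear part of \<open>Phi\<close> subtracts the symbol that belongs to the zero vector, which
  cancels the leading monomials of the polynomial and of the symbol.
\<close>
lemma Phi_eigenvector_iff:
  assumes "n \<ge> 2"
  shows "Phi_eigenvector n l c \<longleftrightarrow> c \<in> carrier_vec (n - 1) \<and> c \<noteq> 0\<^sub>v (n - 1) \<and>
    symbol n ([:1, 1:] * vec_poly n c) (Polynomial.smult l (vec_poly n c))"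
proof (cases "c \<in> carrier_vec (n - 1)")
  case True
  let ?W = "\<lambda>c. monom 1 (n - 1) + vec_poly n c"
  obtain g where g: "symbol n ([:1, 1:] * ?W c) g" "lead_coeff g = 1" "degree g = n - 1"
    using ex_monic_symbol[OF assms] by blast
  obtain h where h: "symbol n ([:1, 1:] * ?W (0\<^sub>v (n - 1))) h" "lead_coeff h = 1" "degree h = n - 1"
    using ex_monic_symbol[OF assms] by blast
  have v0: "vec_poly n (0\<^sub>v (n - 1)) = 0"
    using assms by (intro poly_eqI) (auto simp: coeff_vec_poly)
  have gh: "symbol n ([:1, 1:] * vec_poly n c) (g - h)"
    using symbol_diff[OF g(1) h(1)] v0 by (simp add: right_diff_distrib[symmetric] del: mult_pCons_left)
  have lin: "Phi_lin n c = vec (n - 1) (\<lambda>i. coeff (g - h) (n - 2 - i))"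
    unfolding Phi_lin_def Phi_eqI[OF assms g(2,3,1)] Phi_eqI[OF assms h(2,3,1)]
    by (rule eq_vecI) auto
  have top: "coeff (g - h) i = 0" if "i \<ge> n - 1" for i
    using that g h by (cases "i = n - 1") (auto simp: coeff_eq_0)
  have "Phi_lin n c = l \<cdot>\<^sub>v c \<longleftrightarrow> g - h = Polynomial.smult l (vec_poly n c)"
  proof
    assume eq: "Phi_lin n c = l \<cdot>\<^sub>v c"
    show "g - h = Polynomial.smult l (vec_poly n c)"
    proof (rule poly_eqI)
      fix i
      show "coeff (g - h) i = coeff (Polynomial.smult l (vec_poly n c)) i"
      proof (cases "i < n - 1")
        case True
        have "Phi_lin n c $ (n - 2 - i) = (l \<cdot>\<^sub>v c) $ (n - 2 - i)" using eq by simp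
        moreover have "n - 2 - (n - 2 - i) = i" "n - 2 - i < n - 1" using True by simp_all
        ultimately show ?thesis
          using True \<open>c \<in> carrier_vec (n - 1)\<close> assms
          by (simp add: lin coeff_vec_poly del: coeff_diff diff_diff_left)
      next
        case False
        then show ?thesis using top[of i] assms by (simp add: coeff_vec_poly)
      qed
    qed
  next
    assume eq: "g - h = Polynomial.smult l (vec_poly n c)"
    show "Phi_lin n c = l \<cdot>\<^sub>v c"
    proof (rule eq_vecI)
      fix i assume "i < dim_vec (l \<cdot>\<^sub>v c)"
      then have i: "i < n - 1" using True by simp
      then have "n - 2 - (n - 2 - i) = i" "n - 2 - i < n - 1" by simp_all
      then have "coeff (vec_poly n c) (n - 2 - i) = c $ i"
        unfolding coeff_vec_poly[OF assms] by (simp only: if_True)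
      then show "Phi_lin n c $ i = (l \<cdot>\<^sub>v c) $ i"
        using i True unfolding lin eq by simp
    qed (use True lin in simp)
  qed
  also have "\<dots> \<longleftrightarrow> symbol n ([:1, 1:] * vec_poly n c) (Polynomial.smult l (vec_poly n c))"
    using gh symbol_unique[OF gh _ order.trans[OF _ assms]] by (metis one_le_numeral)
  finally show ?thesis
    using True by (simp add: Phi_eigenvector_def)
qed (simp add: Phi_eigenvector_def)

section \<open>The eigenvector equation in powers of x + 1\<close>

text \<open>
  The usual expansion of \<open>(w + 1)^(t+1)\<close> in falling factorials of \<open>w + 1\<close>, divided by \<open>w + 1\<close>.
\<close>

lemma Suc_power_Stirling:
  "Suc w ^ t = (\<Sum>s\<le>t. Stirling (Suc t) (Suc s) * (fact s * (w choose s)))"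
proof (induction t)
  case (Suc t)
  let ?F = "\<lambda>s. fact s * (w choose s) :: nat"
  have step: "Suc w * ?F s = Suc s * ?F s + ?F (Suc s)" for s
  proof -
    have "Suc w * (w choose s) = Suc s * (w choose s) + Suc s * (w choose Suc s)"
      using Suc_times_binomial[of s w] by (simp add: algebra_simps)
    then have "fact s * (Suc w * (w choose s))
        = fact s * (Suc s * (w choose s) + Suc s * (w choose Suc s))" by (rule arg_cong)
    then show ?thesis by (simp add: algebra_simps)
  qed
  have "Suc w ^ Suc t = (\<Sum>s\<le>t. Stirling (Suc t) (Suc s) * (Suc w * ?F s))"
    by (simp add: Suc.IH sum_distrib_left mult_ac del: mult_Suc)
  also have "\<dots> = (\<Sum>s\<le>t. Suc s * Stirling (Suc t) (Suc s) * ?F s)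
      + (\<Sum>s\<le>t. Stirling (Suc t) (Suc s) * ?F (Suc s))"
    unfolding step by (simp add: sum.distrib[symmetric] algebra_simps del: Stirling.simps)
  also have "(\<Sum>s\<le>t. Suc s * Stirling (Suc t) (Suc s) * ?F s)
      = (\<Sum>s\<le>Suc t. Suc s * Stirling (Suc t) (Suc s) * ?F s)"
    by simp
  also have "(\<Sum>s\<le>t. Stirling (Suc t) (Suc s) * ?F (Suc s)) = (\<Sum>s\<le>Suc t. Stirling (Suc t) s * ?F s)"
    by (subst sum.atMost_Suc_shift) simp
  finally show ?case
    by (simp only: sum.distrib[symmetric] Stirling.simps(4) add_mult_distrib)
qed simp

lemma Stirling_Suc_self: "2 * Stirling (Suc t) t = t * Suc t"
  by (induction t) simp_all

definition fall :: "nat \<Rightarrow> nat \<Rightarrow> complex" where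
  "fall m s = (\<Prod>i<s. of_nat m - of_nat i)"

lemma fall_eq_fact_choose: "fall m s = of_nat (fact s * (m choose s))"
  by (simp add: fall_def binomial_gbinomial gbinomial_prod_rev atLeast0LessThan)

lemma fall_neq_0: "s \<le> m \<Longrightarrow> fall m s \<noteq> 0"
  by (simp add: fall_eq_fact_choose)

lemma binomial_powers_independent:
  fixes a b :: "nat \<Rightarrow> complex"
  shows "(\<Sum>t\<le>j. Polynomial.smult (a t) ([:1, 1:] ^ (d + t))) = (\<Sum>t\<le>j. Polynomial.smult (b t) ([:1, 1:] ^ (d + t)))
    \<longleftrightarrow> (\<forall>t\<le>j. a t = b t)"
proof
  have shift: "coeff (pcompose (\<Sum>t\<le>j. Polynomial.smult (c t) ([:1, 1:] ^ (d + t))) [:-1, 1:]) (d + r) = c r"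
    if "r \<le> j" for c :: "nat \<Rightarrow> complex" and r
  proof -
    have "pcompose ([:1, 1:] ^ k) [:-1, 1:] = (monom 1 k :: complex poly)" for k
      unfolding monom_altdef
      by (induction k) (simp_all add: pcompose_1 pcompose_mult pcompose_pCons del: mult_pCons_left)
    moreover have "(\<Sum>t\<le>j. c t * (if t = r then 1 else 0)) = (\<Sum>t\<le>j. if t = r then c t else 0)"
      by (intro sum.cong) auto
    ultimately show ?thesis
      using that by (simp add: pcompose_sum pcompose_smult coeff_sum)
  qed
  assume eq: "(\<Sum>t\<le>j. Polynomial.smult (a t) ([:1, 1:] ^ (d + t))) = (\<Sum>t\<le>j. Polynomial.smult (b t) ([:1, 1:] ^ (d + t)))"
  show "\<forall>t\<le>j. a t = b t"
    using shift[of _ a] shift[of _ b] unfolding eq by metis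
qed simp

text \<open>
  Expansion at \<open>-1\<close> suits the problem because \<open>x + 1\<close> becomes \<open>u + v\<close> after homogenization, and this is
  constant along the points \<open>(k, n - k)\<close>.
\<close>
definition shifted_poly :: "nat \<Rightarrow> (nat \<Rightarrow> complex) \<Rightarrow> complex poly" where
  "shifted_poly j b = (\<Sum>r\<le>j. Polynomial.smult (b r) ([:1, 1:] ^ r))"

lemma degree_shifted_poly: "degree (shifted_poly j b) \<le> j"
  unfolding shifted_poly_def
  by (intro degree_sum_le) (auto intro: order.trans[OF degree_smult_le] simp: degree_linear_power)

lemma poly_shifted_poly: "poly (shifted_poly j b) x = (\<Sum>r\<le>j. b r * (1 + x) ^ r)"
  by (simp add: shifted_poly_def poly_sum)

lemma coeff_shifted_poly_top: "coeff (shifted_poly j b) j = b j"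
proof -
  have "coeff ([:1, 1:] ^ r) j = (if r = j then 1 else 0 :: complex)" if "r \<le> j" for r
    using that by (cases "r = j") (auto simp: coeff_linear_power coeff_eq_0 degree_linear_power)
  then have "(\<Sum>r\<le>j. b r * coeff ([:1, 1:] ^ r) j) = (\<Sum>r\<le>j. if r = j then b r else 0)"
    by (intro sum.cong) auto
  then show ?thesis
    by (simp add: shifted_poly_def coeff_sum)
qed

lemma poly_shifted_poly_minus_1: "poly (shifted_poly j b) (-1) = b 0"
  by (simp add: poly_shifted_poly power_0_left if_distrib[of "\<lambda>x. _ * x"] cong: if_cong)

lemma homog_shifted_poly:
  "homog j (shifted_poly j b) u v = (\<Sum>r\<le>j. b r * (u + v) ^ r * v ^ (j - r))"
proof -
  have pow: "homog j ([:1, 1:] ^ r) u v = (u + v) ^ r * v ^ (j - r)" if "r \<le> j" for r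
  proof -
    have 1: "homog d 1 u v = v ^ d" for d
    proof -
      have "homog d 1 u v = (\<Sum>i\<in>{0}. coeff 1 i * u ^ i * v ^ (d - i))"
        unfolding homog_def by (rule sum.mono_neutral_right) (auto simp: coeff_1)
      then show ?thesis by simp
    qed
    show ?thesis
      using homog_mult_binomial_power[of 1 "j - r" r u v] that by (simp add: 1)
  qed
  have sum: "homog j (sum f I) u v = (\<Sum>i\<in>I. homog j (f i) u v)" if "finite I" for f and I :: "nat set"
    using that by (induction I rule: finite_induct) (simp_all add: homog_add, simp add: homog_def)
  show ?thesis
    by (simp add: shifted_poly_def sum homog_smult pow mult.assoc)
qed

text \<open>
  The polynomial of an eigenvector is \<open>x * (x + 1)^(n-j-2) * q\<close>. One factor \<open>x + 1\<close> is left out here,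
  since it belongs to the identification of vectors with polynomials. Hence the exponent is
  \<open>n - j - 3\<close>.
\<close>
definition eigenpoly :: "nat \<Rightarrow> nat \<Rightarrow> complex poly \<Rightarrow> complex poly" where
  "eigenpoly j n q = [:0, 1:] * [:1, 1:] ^ (n - j - 3) * q"

lemma homog_eigenpoly:
  assumes "j + 3 \<le> n" "degree q \<le> j"
  shows "homog (n - 1) (eigenpoly j n q) u v = u * v * (u + v) ^ (n - j - 3) * homog j q u v"
proof -
  define R where "R = q * [:1, 1:] ^ (n - j - 3)"
  have dR: "degree R \<le> n - 3"
    unfolding R_def using assms by (intro order.trans[OF degree_mult_le]) (simp add: degree_linear_power)
  have R: "homog (n - 3) R u v = (u + v) ^ (n - j - 3) * homog j q u v"
    unfolding R_def using homog_mult_binomial_power[OF assms(2), of "n - j - 3" u v] assms(1) by simp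
  have dRx: "degree (R * [:0, 1:]) \<le> Suc (n - 3)"
    using dR by (intro order.trans[OF degree_mult_le]) simp
  have "eigenpoly j n q = (R * [:0, 1:]) * [:1, 0:]"
    by (simp add: eigenpoly_def R_def mult_ac)
  moreover have "n - 1 = Suc (Suc (n - 3))" using assms by simp
  ultimately show ?thesis
    using homog_mult_linear[OF dRx, of 1 0 u v] homog_mult_linear[OF dR, of 0 1 u v] R
    by (simp only:) (simp add: mult_ac)
qed

text \<open>
  Multiplying the binomial coefficients \<open>m choose l\<close> by a polynomial in \<open>m - l\<close> gives the coefficients of
  a combination of the powers \<open>(x + 1)^(m-s)\<close>. This is what turns the eigenvector equation into an
  identity between expansions at \<open>-1\<close>.
\<close>
lemma choose_mult_power:
  assumes "l \<le> m" "t \<le> m"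
  shows "of_nat (m choose l) * of_nat (m - l + 1) ^ t =
    (\<Sum>s\<le>t. of_nat (Stirling (Suc t) (Suc s)) * fall m s * coeff ([:1, 1:] ^ (m - s)) l)"
proof -
  have "(m choose l) * (m - l + 1) ^ t
      = (\<Sum>s\<le>t. Stirling (Suc t) (Suc s) * fact s * ((m choose l) * ((m - l) choose s)))"
    using Suc_power_Stirling[of "m - l" t] by (simp add: sum_distrib_left mult_ac)
  also have "\<dots> = (\<Sum>s\<le>t. Stirling (Suc t) (Suc s) * (fact s * (m choose s)) * ((m - s) choose l))"
    by (simp only: choose_mult_diff mult_ac)
  finally have "(of_nat ((m choose l) * (m - l + 1) ^ t) :: complex)
      = of_nat (\<Sum>s\<le>t. Stirling (Suc t) (Suc s) * (fact s * (m choose s)) * ((m - s) choose l))"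
    by (rule arg_cong)
  then show ?thesis
    by (simp only: coeff_binomial_power fall_eq_fact_choose of_nat_mult of_nat_power of_nat_sum)
qed

lemma eigval_mult_fall:
  assumes "j + 3 \<le> n"
  shows "eigval j n * (of_nat (n - 1) * fall (n - 2) j) = of_nat n ^ (j + 1)"
proof -
  have "(\<Prod>i=1..j+1. of_nat n - of_nat i) = (\<Prod>i<Suc j. of_nat n - of_nat (Suc i) :: complex)"
    by (rule prod.reindex_bij_witness[of _ Suc "\<lambda>i. i - 1"]) auto
  also have "\<dots> = (of_nat n - 1) * (\<Prod>i<j. of_nat n - of_nat (Suc (Suc i)))"
    by (subst prod.lessThan_Suc_shift) simp
  also have "(\<Prod>i<j. of_nat n - of_nat (Suc (Suc i))) = fall (n - 2) j"
    unfolding fall_def using assms by (intro prod.cong) (auto simp: of_nat_diff)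
  also have "of_nat n - 1 = (of_nat (n - 1) :: complex)"
    using assms by (simp add: of_nat_diff)
  finally have *: "(\<Prod>i=1..j+1. of_nat n - of_nat i) = of_nat (n - 1) * fall (n - 2) j" .
  have "of_nat (n - 1) * fall (n - 2) j \<noteq> 0"
    using assms fall_neq_0[of j "n - 2"] by auto
  then show ?thesis
    unfolding eigval_def * by (simp del: of_nat_diff)
qed

text \<open>
  Let \<open>V\<close> be the \<open>eigenpoly\<close>. For \<open>k = 0\<close> and \<open>k = n\<close> both sides of the symbol relation are \<open>0\<close>: the
  polynomial \<open>(x + 1) * V\<close> has no constant term and degree less than \<open>n\<close>, and the homogenization of
  \<open>V\<close> has the factor \<open>k * (n - k)\<close>. So only \<open>k = l + 1\<close> with \<open>l \<le> m = n - 2\<close> matters. There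
  \<open>(n choose k) * k * (n - k) = n * (n - 1) * (m choose l)\<close>, and \<open>choose_mult_power\<close> applies. The value
  of \<open>eigval j n\<close> is exactly what makes the powers of \<open>n\<close> cancel and the first equation, \<open>r = 0\<close>, trivial.
\<close>
lemma symbol_eigenpoly_iff:
  assumes n: "j + 3 \<le> n"
  shows "symbol n ([:1, 1:] * eigenpoly j n (shifted_poly j b))
      (Polynomial.smult (eigval j n) (eigenpoly j n (shifted_poly j b))) \<longleftrightarrow>
    (\<forall>r\<le>j. fall (n - 2) j * b r = fall (n - 2) (j - r) *
        (\<Sum>i\<le>r. b i * of_nat n ^ i * of_nat (Stirling (Suc (j - i)) (Suc (j - r)))))"
  (is "?sym \<longleftrightarrow> (\<forall>r\<le>j. _ = ?\<gamma> r)")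
proof -
  define m where "m = n - 2"
  have m: "n = Suc (Suc m)" "j + 1 \<le> m" using n by (auto simp: m_def)
  let ?q = "shifted_poly j b"
  let ?V = "eigenpoly j n ?q"
  \<comment> \<open>\<open>x * U\<close> is the eigenvector polynomial, and the eigenvector equation becomes \<open>fall m j * U = R\<close>.\<close>
  define U where "U = (\<Sum>t\<le>j. Polynomial.smult (b t) ([:1, 1:] ^ (m - j + t)) :: complex poly)"
  define R where "R = (\<Sum>t\<le>j. Polynomial.smult (?\<gamma> t) ([:1, 1:] ^ (m - j + t)) :: complex poly)"
  have U: "[:1, 1:] * ?V = pCons 0 U"
  proof -
    have "[:1, 1:] * ?V = [:0, 1:] * ([:1, 1:] ^ Suc (n - j - 3) * ?q)"
      by (simp only: eigenpoly_def power_Suc mult_ac)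
    also have "Suc (n - j - 3) = m - j" using m by simp
    also have "[:1, 1:] ^ (m - j) * ?q = U"
      by (simp add: U_def shifted_poly_def sum_distrib_left power_add)
    finally show ?thesis by simp
  qed
  have deg_sum: "degree (\<Sum>t\<le>j. Polynomial.smult (c t) ([:1, 1:] ^ (m - j + t)) :: complex poly) \<le> m" for c
    using m by (intro degree_sum_le) (auto intro: order.trans[OF degree_smult_le] simp: degree_linear_power)
  have dU: "degree U \<le> m" and dR: "degree R \<le> m"
    unfolding U_def R_def by (rule deg_sum)+
  have dV: "degree ?V \<le> n - 1"
  proof -
    have "degree ?V \<le> 1 + (n - j - 3) + j"
      unfolding eigenpoly_def using degree_shifted_poly[of j b]
      by (intro order.trans[OF degree_mult_le] add_mono) (simp_all add: degree_linear_power)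
    then show ?thesis using n by simp
  qed
  define G where "G l = (\<Sum>r\<le>j. b r * of_nat n ^ r * of_nat (m - l + 1) ^ (j - r))" for l
  have cR: "coeff R l = of_nat (m choose l) * G l" if l: "l \<le> m" for l
  proof -
    have "of_nat (m choose l) * G l = (\<Sum>r\<le>j. b r * of_nat n ^ r * (of_nat (m choose l) * of_nat (m - l + 1) ^ (j - r)))"
      by (simp add: G_def sum_distrib_left mult_ac)
    also have "\<dots> = (\<Sum>r\<le>j. b r * of_nat n ^ r *
        (\<Sum>s\<le>j - r. of_nat (Stirling (Suc (j - r)) (Suc s)) * fall m s * coeff ([:1, 1:] ^ (m - s)) l))"
      using l m by (intro sum.cong refl arg_cong2[of _ _ _ _ "(*)"] choose_mult_power) auto
    \<comment> \<open>\<open>t = j - s\<close>, so that all powers have the form \<open>m - j + t\<close>, and then the sums are swapped.\<close>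
    also have "\<dots> = (\<Sum>r\<le>j. \<Sum>t\<in>{r..j}. b r * of_nat n ^ r *
        (of_nat (Stirling (Suc (j - r)) (Suc (j - t))) * fall m (j - t) * coeff ([:1, 1:] ^ (m - j + t)) l))"
      unfolding sum_distrib_left
      by (intro sum.cong refl sum.reindex_bij_witness[of _ "\<lambda>t. j - t" "\<lambda>s. j - s"])
        (use m in auto)
    also have "\<dots> = (\<Sum>t\<le>j. \<Sum>r\<le>t. b r * of_nat n ^ r *
        (of_nat (Stirling (Suc (j - r)) (Suc (j - t))) * fall m (j - t) * coeff ([:1, 1:] ^ (m - j + t)) l))"
      unfolding sum.Sigma[OF finite_atMost ballI[OF finite_atLeastAtMost]] sum.Sigma[OF finite_atMost ballI[OF finite_atMost]]
      by (rule sum.reindex_bij_witness[of _ "\<lambda>(t, r). (r, t)" "\<lambda>(r, t). (t, r)"]) auto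
    also have "\<dots> = coeff R l"
      by (simp add: R_def coeff_sum sum_distrib_left sum_distrib_right mult_ac m_def)
    finally show ?thesis ..
  qed
  have hV: "homog (n - 1) ?V (of_nat (Suc l)) (of_nat (n - Suc l)) =
      of_nat (Suc l) * of_nat (m - l + 1) * of_nat n ^ (n - j - 3) * G l" if l: "l \<le> m" for l
  proof -
    have "n - Suc l = m - l + 1" "(of_nat (Suc l) + of_nat (m - l + 1) :: complex) = of_nat n"
      using l m by (simp_all add: of_nat_diff Suc_diff_le)
    then show ?thesis
      by (simp only: homog_eigenpoly[OF n degree_shifted_poly] homog_shifted_poly G_def)
  qed
  have ch: "of_nat (n choose Suc l) * (of_nat (Suc l) * of_nat (m - l + 1)) = (of_nat n * of_nat (n - 1) * of_nat (m choose l) :: complex)"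
    if l: "l \<le> m" for l
  proof -
    have "(n choose Suc l) * Suc l = n * (Suc m choose l)"
      using Suc_times_binomial[of l "Suc m"] m by (simp only: mult.commute)
    moreover have "(m - l + 1) * (Suc m choose l) = Suc m * (m choose l)"
      using binomial_absorb_comp[of "Suc m" l] l by (simp add: Suc_diff_le)
    ultimately have "(n choose Suc l) * (Suc l * (m - l + 1)) = n * (n - 1) * (m choose l)"
      using m(1) by (metis diff_Suc_1 mult.assoc mult.commute)
    then show ?thesis by (metis of_nat_mult)
  qed
  have pn: "(of_nat n :: complex) ^ (n - 1) \<noteq> 0" using n by simp
  have cond: "of_nat n ^ (n - 1) * coeff ([:1, 1:] * ?V) (Suc l) =
      of_nat (n choose Suc l) * homog (n - 1) (Polynomial.smult (eigval j n) ?V) (of_nat (Suc l)) (of_nat (n - Suc l))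
      \<longleftrightarrow> fall m j * coeff U l = coeff R l" (is "?lhs \<longleftrightarrow> _") if l: "l \<le> m" for l
  proof -
    have nj: "n - 1 = (j + 1) + 1 + (n - j - 3)" using n by simp
    have f: "of_nat (n - 1) * fall m j \<noteq> 0" using fall_neq_0[of j m] m(2) n by simp
    have "?lhs \<longleftrightarrow> of_nat n ^ (n - 1) * coeff U l = eigval j n * of_nat n ^ (n - j - 3) *
        (of_nat (n choose Suc l) * (of_nat (Suc l) * of_nat (m - l + 1))) * G l"
      unfolding U homog_smult hV[OF l] by (simp add: mult_ac del: of_nat_Suc)
    also have "\<dots> \<longleftrightarrow> of_nat n ^ (n - 1) * coeff U l =
        eigval j n * of_nat n ^ (n - j - 3) * (of_nat n * of_nat (n - 1)) * coeff R l"
      unfolding ch[OF l] cR[OF l] by (simp only: mult_ac)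
    also have "\<dots> \<longleftrightarrow> (of_nat (n - 1) * fall m j) * (of_nat n ^ (n - 1) * coeff U l) =
        (of_nat (n - 1) * fall m j) * (eigval j n * of_nat n ^ (n - j - 3) * (of_nat n * of_nat (n - 1)) * coeff R l)"
      using f by (simp only: mult_left_cancel simp_thms)
    also have "(of_nat (n - 1) * fall m j) * (eigval j n * of_nat n ^ (n - j - 3) * (of_nat n * of_nat (n - 1)) * coeff R l)
        = (of_nat n ^ (j + 1) * of_nat n * of_nat n ^ (n - j - 3)) * (of_nat (n - 1) * coeff R l)"
      unfolding eigval_mult_fall[OF n, symmetric] m_def by (simp only: mult_ac)
    also have "of_nat n ^ (j + 1) * of_nat n * of_nat n ^ (n - j - 3) = (of_nat n ^ (n - 1) :: complex)"
      unfolding nj power_add by simp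
    also have "(of_nat (n - 1) * fall m j * (of_nat n ^ (n - 1) * coeff U l) =
        of_nat n ^ (n - 1) * (of_nat (n - 1) * coeff R l)) \<longleftrightarrow>
        (of_nat n ^ (n - 1) * of_nat (n - 1)) * (fall m j * coeff U l) =
        (of_nat n ^ (n - 1) * of_nat (n - 1)) * coeff R l"
      by (simp only: mult_ac)
    also have "\<dots> \<longleftrightarrow> fall m j * coeff U l = coeff R l"
      using pn f by (subst mult_left_cancel) auto
    finally show ?thesis .
  qed
  have cond0: "of_nat n ^ (n - 1) * coeff ([:1, 1:] * ?V) 0 =
      of_nat (n choose 0) * homog (n - 1) (Polynomial.smult (eigval j n) ?V) (of_nat 0) (of_nat (n - 0))"
    unfolding U homog_smult homog_eigenpoly[OF n degree_shifted_poly] by simp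
  have condn: "of_nat n ^ (n - 1) * coeff ([:1, 1:] * ?V) n =
      of_nat (n choose n) * homog (n - 1) (Polynomial.smult (eigval j n) ?V) (of_nat n) (of_nat (n - n))"
    unfolding U homog_smult homog_eigenpoly[OF n degree_shifted_poly] using m dU
    by (simp add: coeff_eq_0)
  have "?sym \<longleftrightarrow> (\<forall>k\<le>n. of_nat n ^ (n - 1) * coeff ([:1, 1:] * ?V) k =
      of_nat (n choose k) * homog (n - 1) (Polynomial.smult (eigval j n) ?V) (of_nat k) (of_nat (n - k)))"
  proof -
    have "degree ([:1, 1:] * ?V) \<le> n"
      unfolding U using dU m by (intro order.trans[OF degree_pCons_le]) simp
    moreover have "degree (Polynomial.smult (eigval j n) ?V) \<le> n - 1"
      using dV by (rule order.trans[OF degree_smult_le])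
    ultimately show ?thesis by (simp only: symbol_def simp_thms)
  qed
  also have "\<dots> \<longleftrightarrow> (\<forall>l\<le>m. fall m j * coeff U l = coeff R l)"
  proof (intro iffI allI impI)
    fix l assume all: "\<forall>k\<le>n. of_nat n ^ (n - 1) * coeff ([:1, 1:] * ?V) k =
      of_nat (n choose k) * homog (n - 1) (Polynomial.smult (eigval j n) ?V) (of_nat k) (of_nat (n - k))"
      and l: "l \<le> m"
    have "Suc l \<le> n" using l m by simp
    then show "fall m j * coeff U l = coeff R l" using all cond[OF l] by blast
  next
    fix k assume all: "\<forall>l\<le>m. fall m j * coeff U l = coeff R l" and k: "k \<le> n"
    show "of_nat n ^ (n - 1) * coeff ([:1, 1:] * ?V) k =
      of_nat (n choose k) * homog (n - 1) (Polynomial.smult (eigval j n) ?V) (of_nat k) (of_nat (n - k))"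
    proof (cases k)
      case 0
      then show ?thesis using cond0 by blast
    next
      case (Suc l)
      show ?thesis
      proof (cases "l \<le> m")
        case True
        then show ?thesis unfolding Suc using all cond by blast
      next
        case False
        then have "k = n" using k Suc m by simp
        then show ?thesis using condn by blast
      qed
    qed
  qed
  also have "\<dots> \<longleftrightarrow> Polynomial.smult (fall m j) U = R"
  proof
    assume all: "\<forall>l\<le>m. fall m j * coeff U l = coeff R l"
    show "Polynomial.smult (fall m j) U = R"
    proof (rule poly_eqI)
      fix l
      show "coeff (Polynomial.smult (fall m j) U) l = coeff R l"
        using all dU dR by (cases "l \<le> m") (simp_all add: coeff_eq_0)
    qed
  qed auto
  also have "Polynomial.smult (fall m j) U = (\<Sum>t\<le>j. Polynomial.smult (fall m j * b t) ([:1, 1:] ^ (m - j + t)))"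
    by (rule poly_eqI) (simp add: U_def coeff_sum sum_distrib_left mult.assoc)
  also have "\<dots> = R \<longleftrightarrow> (\<forall>t\<le>j. fall m j * b t = ?\<gamma> t)"
    unfolding R_def by (rule binomial_powers_independent)
  finally show ?thesis unfolding m_def .
qed

section \<open>Solution of the triangular system\<close>

text \<open>
  The diagonal entry of the system in row \<open>r\<close>, after division by \<open>fall (n - 2) (j - r)\<close>.
\<close>

definition pivot :: "nat \<Rightarrow> nat \<Rightarrow> nat \<Rightarrow> complex" where
  "pivot j n r = (\<Prod>t<r. of_nat n - of_nat (j + 1 - t)) - of_nat n ^ r"

lemma fall_split:
  assumes "j + 3 \<le> n" "r \<le> j"
  shows "fall (n - 2) j = fall (n - 2) (j - r) * (\<Prod>t<r. of_nat n - of_nat (j + 1 - t))"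
proof -
  have "(\<Prod>i\<in>{j-r..<j}. of_nat (n - 2) - of_nat i) = (\<Prod>t<r. of_nat n - of_nat (j + 1 - t) :: complex)"
    by (rule prod.reindex_bij_witness[of _ "\<lambda>t. j - 1 - t" "\<lambda>i. j - 1 - i"])
      (use assms in \<open>auto simp: of_nat_diff\<close>)
  moreover have "{..<j} = {..<j - r} \<union> {j-r..<j}" "{..<j - r} \<inter> {j-r..<j} = {}"
    by auto
  ultimately show ?thesis
    unfolding fall_def by (simp add: prod.union_disjoint)
qed

lemma pivot_neq_0:
  assumes "j + 3 \<le> n" "0 < r" "r \<le> j"
  shows "pivot j n r \<noteq> 0"
proof -
  \<comment> \<open>The pivot is negative, since every factor is less than \<open>n\<close>.\<close>
  have "(\<Prod>t<r. n - (j + 1 - t)) \<le> (\<Prod>t<r. n - 1)"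
    using assms by (intro prod_mono) auto
  also have "\<dots> < n ^ r"
    using assms by (simp add: power_strict_mono)
  finally have "(\<Prod>t<r. n - (j + 1 - t)) \<noteq> n ^ r" by simp
  then have "(of_nat (\<Prod>t<r. n - (j + 1 - t)) :: complex) \<noteq> of_nat (n ^ r)"
    by (simp only: of_nat_eq_iff not_False_eq_True)
  also have "of_nat (\<Prod>t<r. n - (j + 1 - t)) = (\<Prod>t<r. of_nat n - of_nat (j + 1 - t) :: complex)"
    unfolding of_nat_prod using assms by (intro prod.cong refl of_nat_diff) auto
  finally show ?thesis by (simp add: pivot_def)
qed

text \<open>
  Forward substitution with the value \<open>1\<close> for the free unknown: multiples of these numbers are the
  coefficients of \<open>Q_poly j n\<close> in powers of \<open>x + 1\<close>.
\<close>
fun Q_coeff :: "nat \<Rightarrow> nat \<Rightarrow> nat \<Rightarrow> complex" where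
  "Q_coeff j n 0 = 1"
| "Q_coeff j n (Suc r) = (\<Sum>i\<le>r. Q_coeff j n i * of_nat n ^ i *
     of_nat (Stirling (Suc (j - i)) (Suc (j - Suc r)))) / pivot j n (Suc r)"

lemma eigen_equations_iff:
  assumes n: "j + 3 \<le> n"
  shows "(\<forall>r\<le>j. fall (n - 2) j * b r = fall (n - 2) (j - r) *
        (\<Sum>i\<le>r. b i * of_nat n ^ i * of_nat (Stirling (Suc (j - i)) (Suc (j - r)))))
    \<longleftrightarrow> (\<forall>r\<le>j. b r = b 0 * Q_coeff j n r)"
proof -
  let ?S = "\<lambda>r i. of_nat (Stirling (Suc (j - i)) (Suc (j - r))) :: complex"
  have row: "fall (n - 2) j * b r = fall (n - 2) (j - r) * (\<Sum>i\<le>r. b i * of_nat n ^ i * ?S r i)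
      \<longleftrightarrow> pivot j n r * b r = (\<Sum>i<r. b i * of_nat n ^ i * ?S r i)" if r: "r \<le> j" for r
  proof -
    have f: "fall (n - 2) (j - r) \<noteq> 0" using n by (intro fall_neq_0) simp
    have "(\<Sum>i\<le>r. b i * of_nat n ^ i * ?S r i) = (\<Sum>i<r. b i * of_nat n ^ i * ?S r i) + b r * of_nat n ^ r"
      by (simp add: lessThan_Suc_atMost[symmetric] del: Stirling.simps)
    then show ?thesis
      unfolding fall_split[OF n r] mult.assoc mult_left_cancel[OF f] pivot_def
      by (auto simp: algebra_simps)
  qed
  have step: "pivot j n (Suc r) * (c * Q_coeff j n (Suc r)) = (\<Sum>i<Suc r. (c * Q_coeff j n i) * of_nat n ^ i * ?S (Suc r) i)"
    if "Suc r \<le> j" for r c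
  proof -
    have "pivot j n (Suc r) * (c * Q_coeff j n (Suc r)) = c * (\<Sum>i\<le>r. Q_coeff j n i * of_nat n ^ i * ?S (Suc r) i)"
      using pivot_neq_0[OF n _ that] by simp
    then show ?thesis
      by (simp add: lessThan_Suc_atMost sum_distrib_left mult_ac del: Q_coeff.simps Stirling.simps)
  qed
  have "(\<forall>r\<le>j. pivot j n r * b r = (\<Sum>i<r. b i * of_nat n ^ i * ?S r i))
      \<longleftrightarrow> (\<forall>r\<le>j. b r = b 0 * Q_coeff j n r)"
  proof (intro iffI allI impI)
    fix r assume eqs: "\<forall>r\<le>j. pivot j n r * b r = (\<Sum>i<r. b i * of_nat n ^ i * ?S r i)" and "r \<le> j"
    from \<open>r \<le> j\<close> show "b r = b 0 * Q_coeff j n r"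
    proof (induction r rule: less_induct)
      case (less r)
      show ?case
      proof (cases r)
        case (Suc k)
        have "pivot j n r * b r = (\<Sum>i<r. b i * of_nat n ^ i * ?S r i)"
          using eqs less.prems by blast
        also have "\<dots> = (\<Sum>i<r. (b 0 * Q_coeff j n i) * of_nat n ^ i * ?S r i)"
        proof (rule sum.cong[OF refl])
          fix i assume "i \<in> {..<r}"
          then have "i < r" "i \<le> j" using less.prems by auto
          then have "b i = b 0 * Q_coeff j n i" by (rule less.IH)
          then show "b i * of_nat n ^ i * ?S r i = (b 0 * Q_coeff j n i) * of_nat n ^ i * ?S r i"
            by (rule arg_cong)
        qed
        also have "\<dots> = pivot j n r * (b 0 * Q_coeff j n r)"
          using step[of k "b 0"] less.prems unfolding Suc by metis
        finally have "pivot j n r * b r = pivot j n r * (b 0 * Q_coeff j n r)" .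
        moreover have "pivot j n r \<noteq> 0" using less.prems Suc by (intro pivot_neq_0[OF n]) auto
        ultimately show ?thesis using mult_left_cancel by blast
      qed simp
    qed
  next
    fix r assume sol: "\<forall>r\<le>j. b r = b 0 * Q_coeff j n r" and r: "r \<le> j"
    show "pivot j n r * b r = (\<Sum>i<r. b i * of_nat n ^ i * ?S r i)"
    proof (cases r)
      case (Suc k)
      have "(\<Sum>i<r. b i * of_nat n ^ i * ?S r i) = (\<Sum>i<r. (b 0 * Q_coeff j n i) * of_nat n ^ i * ?S r i)"
      proof (rule sum.cong[OF refl])
        fix i assume "i \<in> {..<r}"
        then have "i \<le> j" using r by simp
        then have "b i = b 0 * Q_coeff j n i" using sol by blast
        then show "b i * of_nat n ^ i * ?S r i = (b 0 * Q_coeff j n i) * of_nat n ^ i * ?S r i"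
          by (rule arg_cong)
      qed
      also have "\<dots> = pivot j n r * (b 0 * Q_coeff j n r)"
        using step[of k "b 0"] r unfolding Suc by metis
      also have "b 0 * Q_coeff j n r = b r" using sol r by metis
      finally show ?thesis by simp
    qed (simp add: pivot_def)
  qed
  then show ?thesis using row by simp
qed

lemma shifted_poly_coeffs:
  assumes "degree q \<le> j"
  shows "q = shifted_poly j (coeff (pcompose q [:-1, 1:]))"
  unfolding shifted_poly_def by (rule poly_eq_sum_shift[OF assms])

text \<open>
  Cancelling \<open>x + 1\<close> shows that at most one vector belongs to \<open>q\<close>, so the existential statement in the
  definition of \<open>Q_poly\<close> becomes a condition on \<open>q\<close> alone.
\<close>
lemma Phi_eigenvector_poly_iff:
  assumes n: "j + 3 \<le> n" and q: "degree q = j" "q \<noteq> 0"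
  shows "(\<exists>c. Phi_eigenvector n (eigval j n) c \<and>
      [:1, 1:] * vec_poly n c = [:0, 1:] * [:1, 1:] ^ (n - j - 2) * q) \<longleftrightarrow>
    symbol n ([:1, 1:] * eigenpoly j n q) (Polynomial.smult (eigval j n) (eigenpoly j n q))"
proof -
  have n2: "n \<ge> 2" using n by simp
  have "[:0, 1:] * [:1, 1:] ^ (n - j - 2) * q = [:1, 1:] * eigenpoly j n q"
  proof -
    have "n - j - 2 = Suc (n - j - 3)" using n by simp
    then show ?thesis by (simp only: eigenpoly_def power_Suc mult_ac)
  qed
  then have eq: "[:1, 1:] * vec_poly n c = [:0, 1:] * [:1, 1:] ^ (n - j - 2) * q
      \<longleftrightarrow> vec_poly n c = eigenpoly j n q" for c
    by (simp only: mult_left_cancel pCons_eq_0_iff one_neq_zero simp_thms if_False mult_cancel_left)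
  have ne: "eigenpoly j n q \<noteq> 0" using q by (simp add: eigenpoly_def del: mult_pCons_left)
  have dV: "degree (eigenpoly j n q) \<le> n - 2"
  proof -
    have "degree (eigenpoly j n q) \<le> 1 + (n - j - 3) + j"
      unfolding eigenpoly_def using q
      by (intro order.trans[OF degree_mult_le] add_mono) (simp_all add: degree_linear_power)
    then show ?thesis using n by simp
  qed
  let ?c = "vec (n - 1) (\<lambda>i. coeff (eigenpoly j n q) (n - 2 - i))"
  have c: "vec_poly n ?c = eigenpoly j n q" using n2 dV by (rule vec_poly_vec)
  have "vec_poly n (0\<^sub>v (n - 1)) = 0"
    using n2 by (intro poly_eqI) (auto simp: coeff_vec_poly)
  then have "?c \<noteq> 0\<^sub>v (n - 1)" using c ne by metis
  then show ?thesis
    unfolding eq Phi_eigenvector_iff[OF n2] using c by (metis vec_carrier)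
qed

text \<open>
  The solutions form a line, on which the normalization as a monic polynomial selects a point if the
  coefficient of \<open>(x + 1)^j\<close> is not \<open>0\<close>. This holds for all large \<open>n\<close>, as \<open>Q_coeff j n j\<close> has a
  nonzero limit.
\<close>
lemma Q_poly_eq:
  assumes n: "j + 3 \<le> n" and top: "Q_coeff j n j \<noteq> 0"
  shows "Q_poly j n = shifted_poly j (\<lambda>r. Q_coeff j n r / Q_coeff j n j)"
  unfolding Q_poly_def
proof (rule the_equality, goal_cases)
  let ?b = "\<lambda>r. Q_coeff j n r / Q_coeff j n j"
  let ?q = "shifted_poly j ?b"
  case 1
  have deg: "degree ?q = j"
    using degree_shifted_poly[of j ?b] top
    by (intro antisym le_degree) (auto simp: coeff_shifted_poly_top)
  have "\<forall>r\<le>j. ?b r = ?b 0 * Q_coeff j n r" by simp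
  then have "symbol n ([:1, 1:] * eigenpoly j n ?q) (Polynomial.smult (eigval j n) (eigenpoly j n ?q))"
    unfolding symbol_eigenpoly_iff[OF n] eigen_equations_iff[OF n] .
  moreover have "lead_coeff ?q = 1" unfolding deg using top by (simp add: coeff_shifted_poly_top)
  moreover from this have "?q \<noteq> 0" by auto
  moreover have "poly ?q (-1) \<noteq> 0" using top by (simp add: poly_shifted_poly_minus_1)
  ultimately show ?case using Phi_eigenvector_poly_iff[OF n deg] deg by simp
next
  case (2 q)
  define b where "b = coeff (pcompose q [:-1, 1:])"
  have q: "q = shifted_poly j b"
    using 2 unfolding b_def by (intro shifted_poly_coeffs) simp
  have "q \<noteq> 0" using 2 by auto
  then have "symbol n ([:1, 1:] * eigenpoly j n q) (Polynomial.smult (eigval j n) (eigenpoly j n q))"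
    using Phi_eigenvector_poly_iff[OF n, of q] 2 by simp
  then have b: "\<forall>r\<le>j. b r = b 0 * Q_coeff j n r"
    unfolding q symbol_eigenpoly_iff[OF n] eigen_equations_iff[OF n] .
  have "b j = 1" using 2 coeff_shifted_poly_top[of j b] q by metis
  then have "1 = b 0 * Q_coeff j n j" using b by (metis order_refl)
  then have b0: "b 0 = 1 / Q_coeff j n j" using top by (simp add: eq_divide_eq)
  have "b r = Q_coeff j n r / Q_coeff j n j" if "r \<le> j" for r
  proof -
    have "b r = b 0 * Q_coeff j n r" using b that by blast
    then show ?thesis unfolding b0 by simp
  qed
  then show "q = shifted_poly j (\<lambda>r. Q_coeff j n r / Q_coeff j n j)"
    unfolding q shifted_poly_def by (intro sum.cong) auto
qed

section \<open>The limit\<close>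

text \<open>The solution of the limiting two-term recursion with the initial value \<open>1\<close>.\<close>

definition Q_coeff_lim :: "nat \<Rightarrow> nat \<Rightarrow> complex" where
  "Q_coeff_lim j r = (-1) ^ r * of_nat ((j + 1) choose r) * of_nat ((2 * j + 2 - r) choose (j + 2))
     / of_nat ((2 * j + 2) choose (j + 2))"

lemma of_nat_choose_neq_0: "k \<le> n \<Longrightarrow> (of_nat (n choose k) :: complex) \<noteq> 0"
  by simp

lemma Q_coeff_lim_0: "Q_coeff_lim j 0 = 1"
proof -
  have "(of_nat ((2 * j + 2) choose (j + 2)) :: complex) \<noteq> 0"
    by (rule of_nat_choose_neq_0) simp
  then show ?thesis
    unfolding Q_coeff_lim_def diff_zero power_0 binomial_n_0 of_nat_1 mult_1_left by (rule divide_self)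
qed

lemma Q_coeff_lim_neq_0:
  assumes "r \<le> j"
  shows "Q_coeff_lim j r \<noteq> 0"
proof -
  have "j + 2 \<le> 2 * j + 2 - r" "j + 2 \<le> 2 * j + 2" "r \<le> j + 1" using assms by auto
  from this[THEN of_nat_choose_neq_0] show ?thesis
    unfolding Q_coeff_lim_def
    by (simp only: divide_eq_0_iff mult_eq_0_iff power_eq_0_iff neg_equal_0_iff_equal one_neq_zero simp_thms)
qed

text \<open>
  In closed form, the Stirling number is \<open>(j - r) * (j - r + 1) / 2\<close> and the sum is
  \<open>(r + 1) * (2 * j + 2 - r) / 2\<close>. The two binomial coefficients in \<open>Q_coeff_lim\<close> change by the factors
  \<open>(j + 1 - r) / (r + 1)\<close> and \<open>(j - r) / (2 * j + 2 - r)\<close>.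
\<close>
lemma Q_coeff_lim_Suc:
  assumes "r < j"
  shows "Q_coeff_lim j (Suc r) = Q_coeff_lim j r * of_nat (Stirling (Suc (j - r)) (j - r))
    / - (\<Sum>t\<le>r. of_nat (j + 1 - t))"
proof -
  obtain d where d: "j = Suc (r + d)" using assms less_iff_Suc_add by auto
  have S: "2 * of_nat (Stirling (Suc (j - r)) (j - r)) = (of_nat (d + 1) * of_nat (d + 2) :: complex)"
  proof -
    have "2 * Stirling (Suc (j - r)) (j - r) = (d + 1) * (d + 2)"
      using Stirling_Suc_self[of "j - r"] d by simp
    then show ?thesis by (metis of_nat_mult of_nat_numeral)
  qed
  have T: "2 * (\<Sum>t\<le>r. of_nat (j + 1 - t)) = (of_nat (r + 1) * of_nat (r + 2 * d + 4) :: complex)"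
  proof -
    have "2 * (\<Sum>t\<le>k. (of_nat j + 1 - of_nat t :: complex)) = of_nat (k + 1) * (2 * of_nat j + 2 - of_nat k)" for k
      by (induction k) (auto simp: algebra_simps)
    moreover have "(\<Sum>t\<le>r. of_nat (j + 1 - t)) = (\<Sum>t\<le>r. (of_nat j + 1 - of_nat t :: complex))"
      using assms by (intro sum.cong) (auto simp: of_nat_diff)
    moreover have "2 * of_nat j + 2 - of_nat r = (of_nat (r + 2 * d + 4) :: complex)"
      using d by simp
    ultimately show ?thesis by metis
  qed
  have c1: "of_nat (r + 1) * of_nat ((j + 1) choose (Suc r)) = (of_nat (d + 2) * of_nat ((j + 1) choose r) :: complex)"
  proof -
    have "Suc r * ((j + 1) choose Suc r) = (j + 1 - r) * ((j + 1) choose r)"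
      by (metis binomial_absorb_comp binomial_absorption)
    also have "j + 1 - r = d + 2" using d by simp
    finally show ?thesis by (metis Suc_eq_plus1 of_nat_mult)
  qed
  have c2: "of_nat (r + 2 * d + 4) * of_nat ((2 * j + 2 - Suc r) choose (j + 2))
      = (of_nat (d + 1) * of_nat ((2 * j + 2 - r) choose (j + 2)) :: complex)"
  proof -
    have "(2 * j + 2 - r - (j + 2)) * ((2 * j + 2 - r) choose (j + 2))
        = (2 * j + 2 - r) * ((2 * j + 2 - r - 1) choose (j + 2))"
      by (rule binomial_absorb_comp)
    moreover have "2 * j + 2 - r - (j + 2) = d + 1" "2 * j + 2 - r = r + 2 * d + 4"
      "2 * j + 2 - r - 1 = 2 * j + 2 - Suc r"
      using d by simp_all
    ultimately show ?thesis by (metis of_nat_mult)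
  qed
  let ?X = "of_nat ((j + 1) choose r) :: complex" and ?X' = "of_nat ((j + 1) choose Suc r) :: complex"
  let ?Y = "of_nat ((2 * j + 2 - r) choose (j + 2)) :: complex"
  let ?Y' = "of_nat ((2 * j + 2 - Suc r) choose (j + 2)) :: complex"
  have nz: "(of_nat (r + 1) * of_nat (r + 2 * d + 4) :: complex) \<noteq> 0"
    unfolding of_nat_mult[symmetric] of_nat_eq_0_iff by simp
  have "(\<Sum>t\<le>r. of_nat (j + 1 - t) :: complex) \<noteq> 0" using T nz by auto
  moreover have "?X' * ?Y' * (\<Sum>t\<le>r. of_nat (j + 1 - t)) = ?X * ?Y * of_nat (Stirling (Suc (j - r)) (j - r))"
  proof -
    have "2 * (?X' * ?Y' * (\<Sum>t\<le>r. of_nat (j + 1 - t))) = ?X' * ?Y' * (2 * (\<Sum>t\<le>r. of_nat (j + 1 - t)))"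
      by (rule mult.left_commute)
    also have "\<dots> = (of_nat (r + 1) * ?X') * (of_nat (r + 2 * d + 4) * ?Y')"
      unfolding T by (simp only: mult_ac)
    also have "\<dots> = ?X * ?Y * (of_nat (d + 1) * of_nat (d + 2))"
      unfolding c1 c2 by (simp only: mult_ac)
    also have "\<dots> = 2 * (?X * ?Y * of_nat (Stirling (Suc (j - r)) (j - r)))"
      unfolding S[symmetric] by (simp only: mult_ac)
    finally show ?thesis by simp
  qed
  ultimately have "?X' * ?Y' = ?X * ?Y * of_nat (Stirling (Suc (j - r)) (j - r)) / (\<Sum>t\<le>r. of_nat (j + 1 - t))"
    by (simp add: eq_divide_eq del: Stirling.simps)
  moreover have "(-1 * e) * x' * y' / B = (e * x * y / B) * S / - Z" if "x' * y' = x * y * S / Z"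
    for e x x' y y' B S Z :: complex
  proof -
    have "(-1 * e) * x' * y' / B = - e * (x' * y') / B" by simp
    then show ?thesis unfolding that by (simp add: mult_ac)
  qed
  ultimately show ?thesis
    unfolding Q_coeff_lim_def power_Suc by blast
qed

text \<open>The first-order term of a product of factors close to \<open>1\<close>.\<close>
lemma tendsto_prod_one_minus:
  fixes a :: "nat \<Rightarrow> complex"
  shows "(\<lambda>n. of_nat n * ((\<Prod>t<r. 1 - a t / of_nat n) - 1)) \<longlonglongrightarrow> - (\<Sum>t<r. a t)"
proof (induction r)
  case (Suc r)
  have a: "(\<lambda>n. a t / of_nat n) \<longlonglongrightarrow> 0" for t
    using tendsto_mult_right_zero[OF lim_inverse_n] by (simp add: divide_inverse)
  have "(\<lambda>n. \<Prod>t<r. 1 - a t / of_nat n) \<longlonglongrightarrow> (\<Prod>t<r. 1 - 0)"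
    by (intro tendsto_prod tendsto_diff tendsto_const a)
  then have p: "(\<lambda>n. \<Prod>t<r. 1 - a t / of_nat n) \<longlonglongrightarrow> 1" by simp
  have "(\<lambda>n. of_nat n * ((\<Prod>t<r. 1 - a t / of_nat n) - 1) - a r * (\<Prod>t<r. 1 - a t / of_nat n))
      \<longlonglongrightarrow> - (\<Sum>t<r. a t) - a r * 1"
    by (intro tendsto_diff tendsto_mult Suc p tendsto_const)
  moreover have "\<forall>\<^sub>F n in sequentially. of_nat n * ((\<Prod>t<r. 1 - a t / of_nat n) - 1) - a r * (\<Prod>t<r. 1 - a t / of_nat n)
      = of_nat n * ((\<Prod>t<Suc r. 1 - a t / of_nat n) - 1)"
    using eventually_gt_at_top[of 0] by eventually_elim (simp add: field_simps)
  ultimately have "(\<lambda>n. of_nat n * ((\<Prod>t<Suc r. 1 - a t / of_nat n) - 1)) \<longlonglongrightarrow> - (\<Sum>t<r. a t) - a r * 1"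
    by (rule Lim_transform_eventually)
  also have "- (\<Sum>t<r. a t) - a r * 1 = - (\<Sum>t<Suc r. a t)" by simp
  finally show ?case .
qed simp

text \<open>
  The powers \<open>n^(r+1)\<close> cancel in the pivot, so that it only grows like \<open>n^r\<close>. This is the order of the
  last summand on the right-hand side of the system, and larger than that of the other summands.
\<close>
lemma tendsto_pivot:
  "(\<lambda>n. pivot j n (Suc r) / of_nat n ^ r) \<longlonglongrightarrow> - (\<Sum>t\<le>r. of_nat (j + 1 - t))"
proof -
  have "\<forall>\<^sub>F n in sequentially. of_nat n * ((\<Prod>t<Suc r. 1 - of_nat (j + 1 - t) / of_nat n) - 1)
      = pivot j n (Suc r) / of_nat n ^ r"
    using eventually_gt_at_top[of 0]
  proof eventually_elim
    case (elim n)
    then have n: "(of_nat n :: complex) \<noteq> 0" by simp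
    have "(\<Prod>t<Suc r. of_nat n - of_nat (j + 1 - t)) = (\<Prod>t<Suc r. of_nat n * (1 - of_nat (j + 1 - t) / of_nat n) :: complex)"
      using n by (intro prod.cong) (simp_all add: field_simps)
    also have "\<dots> = of_nat n ^ Suc r * (\<Prod>t<Suc r. 1 - of_nat (j + 1 - t) / of_nat n)"
      unfolding prod.distrib by simp
    finally have "pivot j n (Suc r) = of_nat n ^ r * (of_nat n * ((\<Prod>t<Suc r. 1 - of_nat (j + 1 - t) / of_nat n) - 1))"
      unfolding pivot_def by (simp add: right_diff_distrib mult_ac del: prod.lessThan_Suc)
    then show ?case using n by simp
  qed
  then show ?thesis
    using tendsto_prod_one_minus[of "\<lambda>t. of_nat (j + 1 - t)" "Suc r"]
    by (simp only: lessThan_Suc_atMost tendsto_cong)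
qed

text \<open>
  After numerator and denominator of the recursion are divided by \<open>n^k\<close>, where \<open>r = k + 1\<close>, only the
  summand with \<open>i = k\<close> survives, and the limit of the pivot is not \<open>0\<close>.
\<close>
lemma tendsto_Q_coeff:
  assumes "r \<le> j"
  shows "(\<lambda>n. Q_coeff j n r) \<longlonglongrightarrow> Q_coeff_lim j r"
  using assms
proof (induction r rule: less_induct)
  case (less r)
  show ?case
  proof (cases r)
    case 0
    then show ?thesis by (simp add: Q_coeff_lim_0)
  next
    case (Suc k)
    let ?S = "\<lambda>i. of_nat (Stirling (Suc (j - i)) (Suc (j - Suc k))) :: complex"
    have ratio: "(\<lambda>n. of_nat n ^ i / of_nat n ^ k) \<longlonglongrightarrow> (if i = k then 1 else 0 :: complex)" if i: "i \<le> k" for i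
    proof (cases "i = k")
      case True
      have "\<forall>\<^sub>F n in sequentially. of_nat n ^ i / of_nat n ^ k = (1 :: complex)"
        using eventually_gt_at_top[of 0] by eventually_elim (simp add: True)
      from tendsto_eventually[OF this] show ?thesis using True by simp
    next
      case False
      then obtain e where e: "k = i + Suc e" using i by (metis le_neq_implies_less less_iff_Suc_add add_Suc_right)
      have "(\<lambda>n. inverse (of_nat n) ^ Suc e) \<longlonglongrightarrow> (0 ^ Suc e :: complex)"
        by (intro tendsto_power lim_inverse_n)
      moreover have "\<forall>\<^sub>F n in sequentially. inverse (of_nat n) ^ Suc e = (of_nat n ^ i / of_nat n ^ k :: complex)"
        using eventually_gt_at_top[of 0]
        by eventually_elim (simp add: e power_add field_simps)
      ultimately show ?thesis using False by (simp add: tendsto_cong)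
    qed
    have "(\<lambda>n. \<Sum>i\<le>k. Q_coeff j n i * (of_nat n ^ i / of_nat n ^ k) * ?S i)
        \<longlonglongrightarrow> (\<Sum>i\<le>k. Q_coeff_lim j i * (if i = k then 1 else 0) * ?S i)"
      using less Suc by (intro tendsto_sum tendsto_mult tendsto_const ratio) auto
    also have "(\<Sum>i\<le>k. Q_coeff_lim j i * (if i = k then 1 else 0) * ?S i) = (\<Sum>i\<le>k. if i = k then Q_coeff_lim j i * ?S i else 0)"
      by (intro sum.cong) auto
    also have "\<dots> = Q_coeff_lim j k * of_nat (Stirling (Suc (j - k)) (j - k))"
      using less.prems Suc by (simp add: Suc_diff_Suc del: Stirling.simps)
    finally have num: "(\<lambda>n. \<Sum>i\<le>k. Q_coeff j n i * (of_nat n ^ i / of_nat n ^ k) * ?S i)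
        \<longlonglongrightarrow> Q_coeff_lim j k * of_nat (Stirling (Suc (j - k)) (j - k))" .
    have "(\<Sum>t\<le>k. of_nat (j + 1 - t) :: complex) = of_nat (\<Sum>t\<le>k. j + 1 - t)"
      by simp
    moreover have "(\<Sum>t\<le>k. j + 1 - t) \<noteq> 0"
      by (auto simp: sum_eq_0_iff)
    ultimately have nz: "- (\<Sum>t\<le>k. of_nat (j + 1 - t) :: complex) \<noteq> 0"
      by (simp only: of_nat_eq_0_iff neg_equal_0_iff_equal not_False_eq_True)
    have "(\<lambda>n. (\<Sum>i\<le>k. Q_coeff j n i * (of_nat n ^ i / of_nat n ^ k) * ?S i) / (pivot j n (Suc k) / of_nat n ^ k))
        \<longlonglongrightarrow> Q_coeff_lim j r"
      unfolding Suc Q_coeff_lim_Suc[of k j, OF Suc_le_lessD[OF less.prems[unfolded Suc]]]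
      by (rule tendsto_divide[OF num tendsto_pivot nz])
    moreover have "\<forall>\<^sub>F n in sequentially. (\<Sum>i\<le>k. Q_coeff j n i * (of_nat n ^ i / of_nat n ^ k) * ?S i) / (pivot j n (Suc k) / of_nat n ^ k)
        = Q_coeff j n r"
      using eventually_gt_at_top[of 0]
    proof eventually_elim
      case (elim n)
      have "(\<Sum>i\<le>k. Q_coeff j n i * (of_nat n ^ i / of_nat n ^ k) * ?S i) = (\<Sum>i\<le>k. Q_coeff j n i * of_nat n ^ i * ?S i) / of_nat n ^ k"
        by (simp add: sum_divide_distrib)
      then show ?case using elim by (simp add: Suc del: Stirling.simps)
    qed
    ultimately show ?thesis by (simp only: tendsto_cong)
  qed
qed

lemma Qstar_eq: "Qstar j = shifted_poly j (\<lambda>r. Q_coeff_lim j r / Q_coeff_lim j j)"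
proof -
  let ?q = "shifted_poly j (\<lambda>r. Q_coeff_lim j r / Q_coeff_lim j j)"
  have lim: "(\<lambda>n. coeff (Q_poly j n) k) \<longlonglongrightarrow> coeff ?q k" for k
  proof -
    have "(\<lambda>n. \<Sum>r\<le>j. Q_coeff j n r / Q_coeff j n j * coeff ([:1, 1:] ^ r) k)
        \<longlonglongrightarrow> (\<Sum>r\<le>j. Q_coeff_lim j r / Q_coeff_lim j j * coeff ([:1, 1:] ^ r) k)"
      by (intro tendsto_intros tendsto_Q_coeff Q_coeff_lim_neq_0) auto
    moreover have "\<forall>\<^sub>F n in sequentially. Q_coeff j n j \<noteq> 0"
      by (rule tendsto_imp_eventually_ne[OF tendsto_Q_coeff Q_coeff_lim_neq_0]) auto
    then have "\<forall>\<^sub>F n in sequentially. (\<Sum>r\<le>j. Q_coeff j n r / Q_coeff j n j * coeff ([:1, 1:] ^ r) k) = coeff (Q_poly j n) k"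
      using eventually_ge_at_top[of "j + 3"]
      by eventually_elim (simp add: Q_poly_eq shifted_poly_def coeff_sum)
    ultimately show ?thesis
      by (simp add: tendsto_cong shifted_poly_def coeff_sum)
  qed
  show ?thesis
    unfolding Qstar_def
  proof (rule the_equality)
    show "\<forall>k. (\<lambda>n. coeff (Q_poly j n) k) \<longlonglongrightarrow> coeff ?q k" using lim by blast
    fix q assume "\<forall>k. (\<lambda>n. coeff (Q_poly j n) k) \<longlonglongrightarrow> coeff q k"
    then show "q = ?q" using lim LIMSEQ_unique by (intro poly_eqI) blast
  qed
qed

section \<open>Narayana polynomials expanded at 1\<close>

lemma sum_choose_vandermonde:
  assumes "r \<le> j"
  shows "(\<Sum>k\<le>j. (Suc j choose k) * (Suc j choose Suc k) * (k choose r))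
    = (Suc j choose r) * ((2 * j + 2 - r) choose (j + 2))"
proof -
  have "(\<Sum>k\<le>j. (Suc j choose k) * (Suc j choose Suc k) * (k choose r)) =
      (\<Sum>k\<in>{r..j}. (Suc j choose Suc k) * ((Suc j choose k) * (k choose r)))"
    by (rule sum.mono_neutral_cong_right) (auto simp: mult_ac)
  also have "\<dots> = (\<Sum>k\<in>{r..j}. (Suc j choose Suc k) * ((Suc j choose r) * ((Suc j - r) choose (k - r))))"
    by (intro sum.cong) (auto simp: choose_mult)
  also have "\<dots> = (Suc j choose r) * (\<Sum>k\<in>{r..j}. ((Suc j - r) choose (k - r)) * (Suc j choose (j - k)))"
  proof -
    have "Suc j choose Suc k = Suc j choose (j - k)" if "k \<le> j" for k
      using that binomial_symmetric[of "Suc k" "Suc j"] by simp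
    then show ?thesis by (simp add: sum_distrib_left mult_ac)
  qed
  also have "(\<Sum>k\<in>{r..j}. ((Suc j - r) choose (k - r)) * (Suc j choose (j - k)))
      = (\<Sum>i\<le>j - r. ((Suc j - r) choose i) * (Suc j choose (j - r - i)))"
    by (rule sum.reindex_bij_witness[of _ "\<lambda>i. i + r" "\<lambda>k. k - r"]) (use assms in auto)
  also have "\<dots> = (Suc j - r + Suc j) choose (j - r)" by (rule vandermonde)
  also have "\<dots> = (2 * j + 2 - r) choose (j + 2)"
  proof -
    have "Suc j - r + Suc j = 2 * j + 2 - r" "2 * j + 2 - r - (j - r) = j + 2" using assms by simp_all
    then show ?thesis using binomial_symmetric[of "j - r" "2 * j + 2 - r"] by simp
  qed
  finally show ?thesis .
qed

text \<open>
  The point \<open>1\<close> enters because \<open>M_poly\<close> evaluates \<open>Qstar\<close> at \<open>-x\<close>, where the powers of \<open>x + 1\<close> turn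
  into powers of \<open>1 - x\<close>.
\<close>
lemma narayana_expansion_at_1:
  "(\<Sum>k\<le>j. of_nat (Suc j choose k) * of_nat (Suc j choose Suc k) * y ^ k) =
    (\<Sum>r\<le>j. of_nat (Suc j choose r) * of_nat ((2 * j + 2 - r) choose (j + 2)) * (y - 1 :: complex) ^ r)"
proof -
  have "y ^ k = (\<Sum>r\<le>j. of_nat (k choose r) * (y - 1) ^ r)" if "k \<le> j" for k
  proof -
    have "y ^ k = ((y - 1) + 1) ^ k" by simp
    also have "\<dots> = (\<Sum>r\<le>k. of_nat (k choose r) * (y - 1) ^ r)"
      unfolding binomial_ring by simp
    also have "\<dots> = (\<Sum>r\<le>j. of_nat (k choose r) * (y - 1) ^ r)"
      using that by (intro sum.mono_neutral_left) auto
    finally show ?thesis .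
  qed
  then have "(\<Sum>k\<le>j. of_nat (Suc j choose k) * of_nat (Suc j choose Suc k) * y ^ k) =
      (\<Sum>k\<le>j. \<Sum>r\<le>j. of_nat ((Suc j choose k) * (Suc j choose Suc k) * (k choose r)) * (y - 1) ^ r)"
    by (simp add: sum_distrib_left mult_ac del: binomial_Suc_Suc)
  also have "\<dots> = (\<Sum>r\<le>j. of_nat (\<Sum>k\<le>j. (Suc j choose k) * (Suc j choose Suc k) * (k choose r)) * (y - 1) ^ r)"
    by (subst sum.swap) (simp add: sum_distrib_right del: binomial_Suc_Suc)
  also have "\<dots> = (\<Sum>r\<le>j. of_nat (Suc j choose r) * of_nat ((2 * j + 2 - r) choose (j + 2)) * (y - 1) ^ r)"
    by (intro sum.cong) (simp_all add: sum_choose_vandermonde del: binomial_Suc_Suc of_nat_sum)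
  finally show ?thesis .
qed

lemma poly_narayana:
  "poly (narayana (Suc j)) x = x * (\<Sum>k\<le>j. of_nat (Suc j choose k) * of_nat (Suc j choose Suc k) * x ^ k) / of_nat (Suc j)"
proof -
  have "poly (narayana (Suc j)) x = (\<Sum>k=1..Suc j. of_nat (Suc j choose (k - 1)) * of_nat (Suc j choose k) / of_nat (Suc j) * x ^ k)"
    by (simp add: narayana_def poly_sum poly_monom del: binomial_Suc_Suc)
  also have "\<dots> = (\<Sum>k\<le>j. of_nat (Suc j choose k) * of_nat (Suc j choose Suc k) / of_nat (Suc j) * x ^ Suc k)"
    by (rule sum.reindex_bij_witness[of _ Suc "\<lambda>k. k - 1"]) auto
  also have "\<dots> = x * (\<Sum>k\<le>j. of_nat (Suc j choose k) * of_nat (Suc j choose Suc k) * x ^ k) / of_nat (Suc j)"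
    by (simp add: sum_distrib_left sum_divide_distrib mult_ac del: binomial_Suc_Suc)
  finally show ?thesis .
qed

theorem theorem5:
  fixes j :: nat
  assumes "j \<ge> 1"
  shows "M_poly j = narayana j"
proof -
  obtain i where i: "j = Suc i" using assms by (cases j) auto
  have ratio: "Q_coeff_lim i r / Q_coeff_lim i i =
      (-1) ^ (r + i) * (of_nat (Suc i choose r) * of_nat ((2 * i + 2 - r) choose (i + 2))) / of_nat (Suc i)" for r
  proof -
    have "Suc i choose i = Suc i" "(2 * i + 2 - i) choose (i + 2) = 1"
      by (simp_all add: binomial_Suc_n)
    then have top: "Q_coeff_lim i i = (-1) ^ i * of_nat (Suc i) / of_nat ((2 * i + 2) choose (i + 2))"
      by (simp add: Q_coeff_lim_def del: binomial_Suc_Suc)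
    have "((-1) ^ r * a * b / B) / ((-1) ^ i * N / B) = (-1) ^ (r + i) * (a * b) / N"
      if "B \<noteq> 0" for a b B N :: complex
      using that by (cases "even i") (simp_all add: power_add)
    note cancel = this
    have "((-1) ^ r * a * b / of_nat ((2 * i + 2) choose (i + 2))) / ((-1) ^ i * N / of_nat ((2 * i + 2) choose (i + 2)))
        = (-1) ^ (r + i) * (a * b) / N" for a b N :: complex
      by (rule cancel) (rule of_nat_choose_neq_0, simp)
    then show ?thesis
      unfolding top Q_coeff_lim_def[of i r] Suc_eq_plus1 .
  qed
  have "poly (M_poly j) x = poly (narayana j) x" for x
  proof -
    have "poly (M_poly j) x = (-1) ^ i * (x * (\<Sum>r\<le>i. Q_coeff_lim i r / Q_coeff_lim i i * (1 - x) ^ r))"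
      by (simp add: M_poly_def i Qstar_eq poly_pcompose poly_shifted_poly)
    also have "(\<Sum>r\<le>i. Q_coeff_lim i r / Q_coeff_lim i i * (1 - x) ^ r) =
        (\<Sum>r\<le>i. (-1) ^ i * (of_nat (Suc i choose r) * of_nat ((2 * i + 2 - r) choose (i + 2)) * (x - 1) ^ r / of_nat (Suc i)))"
    proof (rule sum.cong[OF refl])
      fix r
      have "(-1) ^ r * (1 - x) ^ r = (x - 1) ^ r"
        by (simp flip: power_mult_distrib)
      moreover have "p * q * A / N * z = q * (A * y / N)" if "p * z = y" for p q z y A N :: complex
        unfolding that[symmetric] by simp
      ultimately show "Q_coeff_lim i r / Q_coeff_lim i i * (1 - x) ^ r =
          (-1) ^ i * (of_nat (Suc i choose r) * of_nat ((2 * i + 2 - r) choose (i + 2)) * (x - 1) ^ r / of_nat (Suc i))"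
        unfolding ratio power_add by blast
    qed
    also have "(-1) ^ i * (x * \<dots>) = x * (\<Sum>r\<le>i. of_nat (Suc i choose r) * of_nat ((2 * i + 2 - r) choose (i + 2)) * (x - 1) ^ r) / of_nat (Suc i)"
    proof -
      have "(-1) ^ i * ((-1) ^ i * z) = z" for z :: complex
        by (simp flip: mult.assoc power_mult_distrib)
      then show ?thesis
        by (simp only: sum_distrib_left[symmetric] sum_divide_distrib[symmetric] mult.left_commute[of x] times_divide_eq_right)
    qed
    also have "\<dots> = poly (narayana j) x"
      unfolding i poly_narayana narayana_expansion_at_1 ..
    finally show ?thesis .
  qed
  then show ?thesis by (simp add: poly_eq_poly_eq_iff[symmetric] fun_eq_iff)
qed

end
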